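(* Let $n,s\ge1$, let $\delta:\Sigma\times Q\to\Sigma\times Q\times\{\text{left},\text{right}\}$ be the transition function of a Turing machine with tape alphabet $\Sigma=\{0,\dots,s-1\}$ (blank symbol $0$) and states $Q=\{0,\dots,n-1\}$, and let $A$ be a formula. For every $h\ge0$ there is a component-wise plain proof $${}_h\underline{\mathrm{relstep}}:\;{!}{}_s\mathbf{bool}_A^{\otimes 2h+1}\otimes{!}{}_n\mathbf{bool}_A\;\vdash\;{!}{}_s\mathbf{bool}_A^{\otimes 2h+3}\otimes{!}{}_n\mathbf{bool}_A$$ which encodes a single transition step of the Turing machine using relative tape coordinates. That is: for all $\sigma_{-h},\dots,\sigma_h\in\Sigma$ and $q\in Q$, with $\delta(\sigma_0,q)=(\sigma_0',q',d)$, the cut of ${}_h\underline{\mathrm{relstep}}$ against $\mathrm{prom}(\underline{\sigma_{-h}})\otimes\cdots\otimes\mathrm{prom}(\underline{\sigma_h})\otimes\mathrm{prom}(\underline{q})$ is equivalent under cut-elimination to $\mathrm{prom}(\underline{\rho_{-h-1}})\otimes\cdots\otimes\mathrm{prom}(\underline{\rho_{h+1}})\otimes\mathrm{prom}(\underline{q'})$, where the sequence $(\rho_{-h-1},\dots,\rho_{h+1})$ is $$(0,0,\sigma_{-h},\dots,\sigma_{-1},\sigma_0',\sigma_1,\dots,\sigma_h)\ \text{ if } d=\text{left},\qquad (\sigma_{-h},\dots,\sigma_{-1},\sigma_0',\sigma_1,\dots,\sigma_h,0,0)\ \text{ if } d=\text{right}.$$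
   Context: **Logic.** Linear logic means propositional intuitionistic linear logic with connectives $\otimes,\&,\multimap,!$, as a sequent calculus with one formula on the right: axiom, cut, exchange, left and right rules for $\otimes,\&,\multimap$, and dereliction, weakening, contraction and promotion (from $!\Gamma\vdash B$ infer $!\Gamma\vdash !B$) for $!$. Proofs are considered modulo *equivalence under cut-elimination*: the congruence generated by the standard cut-elimination transformations (including commuting conversions and $\eta$-expansion of axioms), with the structural rules taken up to the usual identities (contraction is associative and commutative, with weakening as unit). $\mathrm{prom}(\pi)$ is the proof obtained from $\pi$ by promotion. "$m\,B$" in a list of hypotheses means $m$ copies of $B$; ${!}B^{\otimes m}$ means $({!}B)^{\otimes m}$. A proof of $!A_1\otimes\cdots\otimes !A_r\vdash C$ is identified, via $\otimes L$, with a proof of $!A_1,\dots,!A_r\vdash C$. **Plain proofs.** A proof of $!A_1,\dots,!A_r\vdash B$ ($r\ge0$) is *plain* if it is equivalent under cut-elimination to one obtained from some proof $\pi$ of $n_1A_1,\dots,n_rA_r\vdash B$ (for some integers $n_i\ge 0$) by derelicting every hypothesis and then, for each $i$, contracting the $n_i$ copies of $!A_i$ into one (if $n_i>1$) or weakening in $!A_i$ (if $n_i=0$). A proof $\psi$ of $!A_1,\dots,!A_r\vdash !B_1\otimes\cdots\otimes !B_t$ is *component-wise plain* if there are plain proofs $\psi_i$ of $!A_1,\dots,!A_r\vdash B_i$ ($1\le i\le t$) such that $\psi$ is equivalent under cut-elimination to the proof obtained from $\bigotimes_{i=1}^t\mathrm{prom}(\psi_i)$, a proof of $t\,!A_1,\dots,t\,!A_r\vdash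 !B_1\otimes\cdots\otimes !B_t$, by contracting the $t$ copies of each $!A_j$. **Data.** ${}_m\mathbf{bool}_A=A^m\multimap A$ where $A^m=A\&\cdots\&A$; for $0\le i\le m-1$, $\underline{i}$ is the proof of ${}_m\mathbf{bool}_A$ given by projection onto the $i$-th coordinate (counted from $0$). In relative coordinates, $\sigma_j$ is the symbol $j$ squares to the right of the head ($\sigma_0$ is scanned); after the step the indices are relative to the new head position. *)

theory Defs
  imports "HOL-Library.FuncSet"
begin

section \<open>Formulas and proofs of intuitionistic linear logic\<close>

datatype 'v fm =
    Atom 'v
  | Tens "'v fm" "'v fm"
  | With "'v fm" "'v fm"
  | Lol "'v fm" "'v fm"
  | Bang "'v fm"

text \<open>
  Every rule with one premise that only acts on the hypotheses replaces a block of consecutive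
  hypotheses by another block and leaves the rest of the sequent alone. An element of the following
  type is such a rule; \<open>prem\<close> is the block in the premise and \<open>concl\<close> the block in the conclusion.
\<close>

datatype 'v lrule =
    Exch "'v fm" "'v fm"
  | TensL "'v fm" "'v fm"
  | WithL1 "'v fm" "'v fm"
  | WithL2 "'v fm" "'v fm"
  | Der "'v fm"
  | Wk "'v fm"
  | Ctr "'v fm"

fun prem :: "'v lrule \<Rightarrow> 'v fm list" where
  "prem (Exch A B) = [A, B]"
| "prem (TensL A B) = [A, B]"
| "prem (WithL1 A B) = [A]"
| "prem (WithL2 A B) = [B]"
| "prem (Der A) = [A]"
| "prem (Wk A) = []"
| "prem (Ctr A) = [Bang A, Bang A]"

fun concl :: "'v lrule \<Rightarrow> 'v fm list" where
  "concl (Exch A B) = [B, A]"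
| "concl (TensL A B) = [Tens A B]"
| "concl (WithL1 A B) = [With A B]"
| "concl (WithL2 A B) = [With A B]"
| "concl (Der A) = [Bang A]"
| "concl (Wk A) = [Bang A]"
| "concl (Ctr A) = [Bang A]"

text \<open>
  Derivation trees. The natural numbers are positions in the list of hypotheses, counted from 0:
  the position of the cut formula in \<open>Cut\<close>, of the formula \<open>B\<close> that the right premise of the left rule
  for \<open>Lol A B\<close> uses in \<open>LolL\<close>, and of the first formula of the block in \<open>Lft\<close>. A tree has at most
  one end sequent.
\<close>

datatype 'v derivation =
    Ax "'v fm"
  | Cut nat "'v derivation" "'v derivation"
  | Lft nat "'v lrule" "'v derivation"
  | TensR "'v derivation" "'v derivation"
  | WithR "'v derivation" "'v derivation"
  | LolR "'v derivation"
  | LolL nat "'v derivation" "'v derivation"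
  | Prom "'v derivation"

inductive proves :: "'v derivation \<Rightarrow> 'v fm list \<Rightarrow> 'v fm \<Rightarrow> bool"
  ("_ \<triangleright> _ \<turnstile> _" [51, 51, 51] 50) where
  ax: "Ax A \<triangleright> [A] \<turnstile> A"
| cut: "p \<triangleright> \<Gamma> \<turnstile> A \<Longrightarrow> q \<triangleright> \<Upsilon> @ A # \<Upsilon>' \<turnstile> B \<Longrightarrow>
    Cut (length \<Upsilon>) p q \<triangleright> \<Upsilon> @ \<Gamma> @ \<Upsilon>' \<turnstile> B"
| lft: "p \<triangleright> \<Upsilon> @ prem \<rho> @ \<Upsilon>' \<turnstile> B \<Longrightarrow>
    Lft (length \<Upsilon>) \<rho> p \<triangleright> \<Upsilon> @ concl \<rho> @ \<Upsilon>' \<turnstile> B"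
| tensR: "p \<triangleright> \<Gamma> \<turnstile> A \<Longrightarrow> q \<triangleright> \<Delta> \<turnstile> B \<Longrightarrow> TensR p q \<triangleright> \<Gamma> @ \<Delta> \<turnstile> Tens A B"
| withR: "p \<triangleright> \<Gamma> \<turnstile> A \<Longrightarrow> q \<triangleright> \<Gamma> \<turnstile> B \<Longrightarrow> WithR p q \<triangleright> \<Gamma> \<turnstile> With A B"
| lolR: "p \<triangleright> A # \<Gamma> \<turnstile> B \<Longrightarrow> LolR p \<triangleright> \<Gamma> \<turnstile> Lol A B"
| lolL: "p \<triangleright> \<Gamma> \<turnstile> A \<Longrightarrow> q \<triangleright> \<Upsilon> @ B # \<Upsilon>' \<turnstile> C \<Longrightarrow>
    LolL (length \<Upsilon>) p q \<triangleright> \<Upsilon> @ \<Gamma> @ Lol A B # \<Upsilon>' \<turnstile> C"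
| prom: "p \<triangleright> map Bang \<Gamma> \<turnstile> B \<Longrightarrow> Prom p \<triangleright> map Bang \<Gamma> \<turnstile> Bang B"

section \<open>Iterated structural rules\<close>

text \<open>\<open>ex_right i B \<Delta>\<close> turns \<open>\<Upsilon>, B, \<Delta>, \<Upsilon>' \<turnstile> C\<close> into \<open>\<Upsilon>, \<Delta>, B, \<Upsilon>' \<turnstile> C\<close>, where \<open>i\<close> is the
  length of \<open>\<Upsilon>\<close>; \<open>ex_left i \<Delta> B\<close> does the converse.\<close>

fun ex_right :: "nat \<Rightarrow> 'v fm \<Rightarrow> 'v fm list \<Rightarrow> 'v derivation \<Rightarrow> 'v derivation" where
  "ex_right i B [] p = p"
| "ex_right i B (D # \<Delta>) p = ex_right (Suc i) B \<Delta> (Lft i (Exch B D) p)"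

fun ex_left :: "nat \<Rightarrow> 'v fm list \<Rightarrow> 'v fm \<Rightarrow> 'v derivation \<Rightarrow> 'v derivation" where
  "ex_left i [] B p = p"
| "ex_left i (D # \<Delta>) B p = Lft i (Exch D B) (ex_left (Suc i) \<Delta> B p)"

text \<open>\<open>wk_block i \<Gamma>\<close> turns \<open>\<Upsilon>, \<Upsilon>' \<turnstile> C\<close> into \<open>\<Upsilon>, !\<Gamma>, \<Upsilon>' \<turnstile> C\<close>, and \<open>ctr_block i \<Gamma>\<close> turns
  \<open>\<Upsilon>, !\<Gamma>, !\<Gamma>, \<Upsilon>' \<turnstile> C\<close> into \<open>\<Upsilon>, !\<Gamma>, \<Upsilon>' \<turnstile> C\<close> by contracting the two copies of each formula.\<close>

fun wk_block :: "nat \<Rightarrow> 'v fm list \<Rightarrow> 'v derivation \<Rightarrow> 'v derivation" where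
  "wk_block i [] p = p"
| "wk_block i (A # \<Gamma>) p = Lft i (Wk A) (wk_block i \<Gamma> p)"

fun ctr_block :: "nat \<Rightarrow> 'v fm list \<Rightarrow> 'v derivation \<Rightarrow> 'v derivation" where
  "ctr_block i [] p = p"
| "ctr_block i (A # \<Gamma>) p =
     ctr_block (Suc i) \<Gamma> (Lft i (Ctr A) (ex_left (Suc i) (map Bang \<Gamma>) (Bang A) p))"

section \<open>Equivalence under cut-elimination\<close>

text \<open>\<open>p \<approx> q \<triangleright> \<Gamma> \<turnstile> A\<close>: the proofs \<open>p\<close> and \<open>q\<close> of \<open>\<Gamma> \<turnstile> A\<close> are equivalent.\<close>

inductive cut_equiv :: "'v derivation \<Rightarrow> 'v derivation \<Rightarrow> 'v fm list \<Rightarrow> 'v fm \<Rightarrow> bool"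
  ("_ \<approx> _ \<triangleright> _ \<turnstile> _" [51, 51, 51, 51] 50) where
  (* congruence *)
  equiv_refl: "p \<triangleright> \<Gamma> \<turnstile> A \<Longrightarrow> p \<approx> p \<triangleright> \<Gamma> \<turnstile> A"
| equiv_sym: "p \<approx> q \<triangleright> \<Gamma> \<turnstile> A \<Longrightarrow> q \<approx> p \<triangleright> \<Gamma> \<turnstile> A"
| equiv_trans: "p \<approx> q \<triangleright> \<Gamma> \<turnstile> A \<Longrightarrow> q \<approx> r \<triangleright> \<Gamma> \<turnstile> A \<Longrightarrow> p \<approx> r \<triangleright> \<Gamma> \<turnstile> A"
| cong_cut: "p \<approx> p' \<triangleright> \<Gamma> \<turnstile> A \<Longrightarrow> q \<approx> q' \<triangleright> \<Upsilon> @ A # \<Upsilon>' \<turnstile> B \<Longrightarrow>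
    Cut (length \<Upsilon>) p q \<approx> Cut (length \<Upsilon>) p' q' \<triangleright> \<Upsilon> @ \<Gamma> @ \<Upsilon>' \<turnstile> B"
| cong_lft: "p \<approx> p' \<triangleright> \<Upsilon> @ prem \<rho> @ \<Upsilon>' \<turnstile> B \<Longrightarrow>
    Lft (length \<Upsilon>) \<rho> p \<approx> Lft (length \<Upsilon>) \<rho> p' \<triangleright> \<Upsilon> @ concl \<rho> @ \<Upsilon>' \<turnstile> B"
| cong_tensR: "p \<approx> p' \<triangleright> \<Gamma> \<turnstile> A \<Longrightarrow> q \<approx> q' \<triangleright> \<Delta> \<turnstile> B \<Longrightarrow>
    TensR p q \<approx> TensR p' q' \<triangleright> \<Gamma> @ \<Delta> \<turnstile> Tens A B"
| cong_withR: "p \<approx> p' \<triangleright> \<Gamma> \<turnstile> A \<Longrightarrow> q \<approx> q' \<triangleright> \<Gamma> \<turnstile> B \<Longrightarrow>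
    WithR p q \<approx> WithR p' q' \<triangleright> \<Gamma> \<turnstile> With A B"
| cong_lolR: "p \<approx> p' \<triangleright> A # \<Gamma> \<turnstile> B \<Longrightarrow> LolR p \<approx> LolR p' \<triangleright> \<Gamma> \<turnstile> Lol A B"
| cong_lolL: "p \<approx> p' \<triangleright> \<Gamma> \<turnstile> A \<Longrightarrow> q \<approx> q' \<triangleright> \<Upsilon> @ B # \<Upsilon>' \<turnstile> C \<Longrightarrow>
    LolL (length \<Upsilon>) p q \<approx> LolL (length \<Upsilon>) p' q' \<triangleright> \<Upsilon> @ \<Gamma> @ Lol A B # \<Upsilon>' \<turnstile> C"
| cong_prom: "p \<approx> p' \<triangleright> map Bang \<Gamma> \<turnstile> B \<Longrightarrow> Prom p \<approx> Prom p' \<triangleright> map Bang \<Gamma> \<turnstile> Bang B"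

  (* eta-expansion of axioms *)
| eta_tens: "Ax (Tens A B) \<approx> Lft 0 (TensL A B) (TensR (Ax A) (Ax B)) \<triangleright> [Tens A B] \<turnstile> Tens A B"
| eta_with: "Ax (With A B) \<approx> WithR (Lft 0 (WithL1 A B) (Ax A)) (Lft 0 (WithL2 A B) (Ax B))
    \<triangleright> [With A B] \<turnstile> With A B"
| eta_lol: "Ax (Lol A B) \<approx> LolR (LolL 0 (Ax A) (Ax B)) \<triangleright> [Lol A B] \<turnstile> Lol A B"
| eta_bang: "Ax (Bang A) \<approx> Prom (Lft 0 (Der A) (Ax A)) \<triangleright> [Bang A] \<turnstile> Bang A"

  (* cut against an axiom *)
| cut_ax_left: "q \<triangleright> \<Upsilon> @ A # \<Upsilon>' \<turnstile> B \<Longrightarrow> Cut (length \<Upsilon>) (Ax A) q \<approx> q \<triangleright> \<Upsilon> @ A # \<Upsilon>' \<turnstile> B"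
| cut_ax_right: "p \<triangleright> \<Gamma> \<turnstile> A \<Longrightarrow> Cut 0 p (Ax A) \<approx> p \<triangleright> \<Gamma> \<turnstile> A"

  (* principal cuts *)
| cut_tens: "p1 \<triangleright> \<Gamma> \<turnstile> A \<Longrightarrow> p2 \<triangleright> \<Delta> \<turnstile> B \<Longrightarrow> q \<triangleright> \<Upsilon> @ A # B # \<Upsilon>' \<turnstile> C \<Longrightarrow>
    Cut (length \<Upsilon>) (TensR p1 p2) (Lft (length \<Upsilon>) (TensL A B) q)
      \<approx> Cut (length \<Upsilon>) p1 (Cut (length \<Upsilon> + 1) p2 q) \<triangleright> \<Upsilon> @ \<Gamma> @ \<Delta> @ \<Upsilon>' \<turnstile> C"
| cut_with1: "p1 \<triangleright> \<Gamma> \<turnstile> A \<Longrightarrow> p2 \<triangleright> \<Gamma> \<turnstile> B \<Longrightarrow> q \<triangleright> \<Upsilon> @ A # \<Upsilon>' \<turnstile> C \<Longrightarrow>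
    Cut (length \<Upsilon>) (WithR p1 p2) (Lft (length \<Upsilon>) (WithL1 A B) q)
      \<approx> Cut (length \<Upsilon>) p1 q \<triangleright> \<Upsilon> @ \<Gamma> @ \<Upsilon>' \<turnstile> C"
| cut_with2: "p1 \<triangleright> \<Gamma> \<turnstile> A \<Longrightarrow> p2 \<triangleright> \<Gamma> \<turnstile> B \<Longrightarrow> q \<triangleright> \<Upsilon> @ B # \<Upsilon>' \<turnstile> C \<Longrightarrow>
    Cut (length \<Upsilon>) (WithR p1 p2) (Lft (length \<Upsilon>) (WithL2 A B) q)
      \<approx> Cut (length \<Upsilon>) p2 q \<triangleright> \<Upsilon> @ \<Gamma> @ \<Upsilon>' \<turnstile> C"
| cut_lol: "p \<triangleright> A # \<Gamma> \<turnstile> B \<Longrightarrow> r \<triangleright> \<Theta> \<turnstile> A \<Longrightarrow> q \<triangleright> \<Upsilon> @ B # \<Upsilon>' \<turnstile> C \<Longrightarrow>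
    Cut (length \<Upsilon> + length \<Theta>) (LolR p) (LolL (length \<Upsilon>) r q)
      \<approx> Cut (length \<Upsilon>) (Cut 0 r p) q \<triangleright> \<Upsilon> @ \<Theta> @ \<Gamma> @ \<Upsilon>' \<turnstile> C"
| cut_prom_der: "p \<triangleright> map Bang \<Gamma> \<turnstile> A \<Longrightarrow> q \<triangleright> \<Upsilon> @ A # \<Upsilon>' \<turnstile> C \<Longrightarrow>
    Cut (length \<Upsilon>) (Prom p) (Lft (length \<Upsilon>) (Der A) q)
      \<approx> Cut (length \<Upsilon>) p q \<triangleright> \<Upsilon> @ map Bang \<Gamma> @ \<Upsilon>' \<turnstile> C"
| cut_prom_wk: "p \<triangleright> map Bang \<Gamma> \<turnstile> A \<Longrightarrow> q \<triangleright> \<Upsilon> @ \<Upsilon>' \<turnstile> C \<Longrightarrow>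
    Cut (length \<Upsilon>) (Prom p) (Lft (length \<Upsilon>) (Wk A) q)
      \<approx> wk_block (length \<Upsilon>) \<Gamma> q \<triangleright> \<Upsilon> @ map Bang \<Gamma> @ \<Upsilon>' \<turnstile> C"
| cut_prom_ctr: "p \<triangleright> map Bang \<Gamma> \<turnstile> A \<Longrightarrow> q \<triangleright> \<Upsilon> @ Bang A # Bang A # \<Upsilon>' \<turnstile> C \<Longrightarrow>
    Cut (length \<Upsilon>) (Prom p) (Lft (length \<Upsilon>) (Ctr A) q)
      \<approx> ctr_block (length \<Upsilon>) \<Gamma> (Cut (length \<Upsilon>) (Prom p) (Cut (length \<Upsilon> + 1) (Prom p) q))
      \<triangleright> \<Upsilon> @ map Bang \<Gamma> @ \<Upsilon>' \<turnstile> C"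
| cut_prom_prom: "p \<triangleright> map Bang \<Gamma> \<turnstile> A \<Longrightarrow> q \<triangleright> map Bang \<Upsilon> @ Bang A # map Bang \<Upsilon>' \<turnstile> C \<Longrightarrow>
    Cut (length \<Upsilon>) (Prom p) (Prom q) \<approx> Prom (Cut (length \<Upsilon>) (Prom p) q)
      \<triangleright> map Bang \<Upsilon> @ map Bang \<Gamma> @ map Bang \<Upsilon>' \<turnstile> Bang C"

  (* the cut formula is exchanged in the right premise *)
| cut_ex_left: "p \<triangleright> \<Gamma> \<turnstile> A \<Longrightarrow> q \<triangleright> \<Upsilon> @ A # B # \<Upsilon>' \<turnstile> C \<Longrightarrow>
    Cut (length \<Upsilon> + 1) p (Lft (length \<Upsilon>) (Exch A B) q)
      \<approx> ex_left (length \<Upsilon>) \<Gamma> B (Cut (length \<Upsilon>) p q) \<triangleright> \<Upsilon> @ B # \<Gamma> @ \<Upsilon>' \<turnstile> C"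
| cut_ex_right: "p \<triangleright> \<Gamma> \<turnstile> B \<Longrightarrow> q \<triangleright> \<Upsilon> @ A # B # \<Upsilon>' \<turnstile> C \<Longrightarrow>
    Cut (length \<Upsilon>) p (Lft (length \<Upsilon>) (Exch A B) q)
      \<approx> ex_right (length \<Upsilon>) A \<Gamma> (Cut (length \<Upsilon> + 1) p q) \<triangleright> \<Upsilon> @ \<Gamma> @ A # \<Upsilon>' \<turnstile> C"

  (* commuting conversions, last rule of the left premise *)
| left_lft: "p \<triangleright> \<Gamma> @ prem \<rho> @ \<Gamma>' \<turnstile> A \<Longrightarrow> q \<triangleright> \<Upsilon> @ A # \<Upsilon>' \<turnstile> C \<Longrightarrow>
    Cut (length \<Upsilon>) (Lft (length \<Gamma>) \<rho> p) q
      \<approx> Lft (length \<Upsilon> + length \<Gamma>) \<rho> (Cut (length \<Upsilon>) p q)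
      \<triangleright> \<Upsilon> @ \<Gamma> @ concl \<rho> @ \<Gamma>' @ \<Upsilon>' \<turnstile> C"
| left_lolL: "r \<triangleright> \<Theta> \<turnstile> D \<Longrightarrow> p \<triangleright> \<Gamma> @ B # \<Gamma>' \<turnstile> A \<Longrightarrow> q \<triangleright> \<Upsilon> @ A # \<Upsilon>' \<turnstile> C \<Longrightarrow>
    Cut (length \<Upsilon>) (LolL (length \<Gamma>) r p) q
      \<approx> LolL (length \<Upsilon> + length \<Gamma>) r (Cut (length \<Upsilon>) p q)
      \<triangleright> \<Upsilon> @ \<Gamma> @ \<Theta> @ Lol D B # \<Gamma>' @ \<Upsilon>' \<turnstile> C"
| left_cut: "r \<triangleright> \<Theta> \<turnstile> D \<Longrightarrow> p \<triangleright> \<Gamma> @ D # \<Gamma>' \<turnstile> A \<Longrightarrow> q \<triangleright> \<Upsilon> @ A # \<Upsilon>' \<turnstile> C \<Longrightarrow>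
    Cut (length \<Upsilon>) (Cut (length \<Gamma>) r p) q
      \<approx> Cut (length \<Upsilon> + length \<Gamma>) r (Cut (length \<Upsilon>) p q)
      \<triangleright> \<Upsilon> @ \<Gamma> @ \<Theta> @ \<Gamma>' @ \<Upsilon>' \<turnstile> C"

  (* commuting conversions, last rule of the right premise; p is cut into a hypothesis that is
     not principal *)
| right_lft_after: "p \<triangleright> \<Gamma> \<turnstile> A \<Longrightarrow> q \<triangleright> \<Upsilon> @ A # \<Upsilon>' @ prem \<rho> @ \<Upsilon>'' \<turnstile> C \<Longrightarrow>
    Cut (length \<Upsilon>) p (Lft (length \<Upsilon> + 1 + length \<Upsilon>') \<rho> q)
      \<approx> Lft (length \<Upsilon> + length \<Gamma> + length \<Upsilon>') \<rho> (Cut (length \<Upsilon>) p q)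
      \<triangleright> \<Upsilon> @ \<Gamma> @ \<Upsilon>' @ concl \<rho> @ \<Upsilon>'' \<turnstile> C"
| right_lft_before: "p \<triangleright> \<Gamma> \<turnstile> A \<Longrightarrow> q \<triangleright> \<Upsilon> @ prem \<rho> @ \<Upsilon>' @ A # \<Upsilon>'' \<turnstile> C \<Longrightarrow>
    Cut (length \<Upsilon> + length (concl \<rho>) + length \<Upsilon>') p (Lft (length \<Upsilon>) \<rho> q)
      \<approx> Lft (length \<Upsilon>) \<rho> (Cut (length \<Upsilon> + length (prem \<rho>) + length \<Upsilon>') p q)
      \<triangleright> \<Upsilon> @ concl \<rho> @ \<Upsilon>' @ \<Gamma> @ \<Upsilon>'' \<turnstile> C"
| right_tensR1: "p \<triangleright> \<Gamma> \<turnstile> A \<Longrightarrow> q \<triangleright> \<Upsilon> @ A # \<Upsilon>' \<turnstile> B \<Longrightarrow> r \<triangleright> \<Delta> \<turnstile> C \<Longrightarrow>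
    Cut (length \<Upsilon>) p (TensR q r) \<approx> TensR (Cut (length \<Upsilon>) p q) r
      \<triangleright> \<Upsilon> @ \<Gamma> @ \<Upsilon>' @ \<Delta> \<turnstile> Tens B C"
| right_tensR2: "p \<triangleright> \<Gamma> \<turnstile> A \<Longrightarrow> q \<triangleright> \<Delta> \<turnstile> B \<Longrightarrow> r \<triangleright> \<Upsilon> @ A # \<Upsilon>' \<turnstile> C \<Longrightarrow>
    Cut (length \<Delta> + length \<Upsilon>) p (TensR q r) \<approx> TensR q (Cut (length \<Upsilon>) p r)
      \<triangleright> \<Delta> @ \<Upsilon> @ \<Gamma> @ \<Upsilon>' \<turnstile> Tens B C"
| right_withR: "p \<triangleright> \<Gamma> \<turnstile> A \<Longrightarrow> q \<triangleright> \<Upsilon> @ A # \<Upsilon>' \<turnstile> B \<Longrightarrow> r \<triangleright> \<Upsilon> @ A # \<Upsilon>' \<turnstile> C \<Longrightarrow>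
    Cut (length \<Upsilon>) p (WithR q r) \<approx> WithR (Cut (length \<Upsilon>) p q) (Cut (length \<Upsilon>) p r)
      \<triangleright> \<Upsilon> @ \<Gamma> @ \<Upsilon>' \<turnstile> With B C"
| right_lolR: "p \<triangleright> \<Gamma> \<turnstile> A \<Longrightarrow> q \<triangleright> B # \<Upsilon> @ A # \<Upsilon>' \<turnstile> C \<Longrightarrow>
    Cut (length \<Upsilon>) p (LolR q) \<approx> LolR (Cut (length \<Upsilon> + 1) p q) \<triangleright> \<Upsilon> @ \<Gamma> @ \<Upsilon>' \<turnstile> Lol B C"
| right_lolL_arg: "p \<triangleright> \<Gamma> \<turnstile> A \<Longrightarrow> r \<triangleright> \<Theta> @ A # \<Theta>' \<turnstile> D \<Longrightarrow> q \<triangleright> \<Upsilon> @ B # \<Upsilon>' \<turnstile> C \<Longrightarrow>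
    Cut (length \<Upsilon> + length \<Theta>) p (LolL (length \<Upsilon>) r q)
      \<approx> LolL (length \<Upsilon>) (Cut (length \<Theta>) p r) q
      \<triangleright> \<Upsilon> @ \<Theta> @ \<Gamma> @ \<Theta>' @ Lol D B # \<Upsilon>' \<turnstile> C"
| right_lolL_after: "p \<triangleright> \<Gamma> \<turnstile> A \<Longrightarrow> r \<triangleright> \<Theta> \<turnstile> D \<Longrightarrow> q \<triangleright> \<Upsilon> @ A # \<Upsilon>' @ B # \<Upsilon>'' \<turnstile> C \<Longrightarrow>
    Cut (length \<Upsilon>) p (LolL (length \<Upsilon> + 1 + length \<Upsilon>') r q)
      \<approx> LolL (length \<Upsilon> + length \<Gamma> + length \<Upsilon>') r (Cut (length \<Upsilon>) p q)
      \<triangleright> \<Upsilon> @ \<Gamma> @ \<Upsilon>' @ \<Theta> @ Lol D B # \<Upsilon>'' \<turnstile> C"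
| right_lolL_before: "p \<triangleright> \<Gamma> \<turnstile> A \<Longrightarrow> r \<triangleright> \<Theta> \<turnstile> D \<Longrightarrow> q \<triangleright> \<Upsilon> @ B # \<Upsilon>' @ A # \<Upsilon>'' \<turnstile> C \<Longrightarrow>
    Cut (length \<Upsilon> + length \<Theta> + 1 + length \<Upsilon>') p (LolL (length \<Upsilon>) r q)
      \<approx> LolL (length \<Upsilon>) r (Cut (length \<Upsilon> + 1 + length \<Upsilon>') p q)
      \<triangleright> \<Upsilon> @ \<Theta> @ Lol D B # \<Upsilon>' @ \<Gamma> @ \<Upsilon>'' \<turnstile> C"
| right_cut: "p \<triangleright> \<Gamma> \<turnstile> A \<Longrightarrow> r \<triangleright> \<Theta> \<turnstile> D \<Longrightarrow> q \<triangleright> \<Upsilon> @ A # \<Upsilon>' @ D # \<Upsilon>'' \<turnstile> C \<Longrightarrow>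
    Cut (length \<Upsilon>) p (Cut (length \<Upsilon> + 1 + length \<Upsilon>') r q)
      \<approx> Cut (length \<Upsilon> + length \<Gamma> + length \<Upsilon>') r (Cut (length \<Upsilon>) p q)
      \<triangleright> \<Upsilon> @ \<Gamma> @ \<Upsilon>' @ \<Theta> @ \<Upsilon>'' \<turnstile> C"

  (* identities for the structural rules *)
| ctr_assoc: "p \<triangleright> \<Upsilon> @ Bang A # Bang A # Bang A # \<Upsilon>' \<turnstile> C \<Longrightarrow>
    Lft (length \<Upsilon>) (Ctr A) (Lft (length \<Upsilon>) (Ctr A) p)
      \<approx> Lft (length \<Upsilon>) (Ctr A) (Lft (length \<Upsilon> + 1) (Ctr A) p) \<triangleright> \<Upsilon> @ Bang A # \<Upsilon>' \<turnstile> C"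
| ctr_comm: "p \<triangleright> \<Upsilon> @ Bang A # Bang A # \<Upsilon>' \<turnstile> C \<Longrightarrow>
    Lft (length \<Upsilon>) (Ctr A) (Lft (length \<Upsilon>) (Exch (Bang A) (Bang A)) p)
      \<approx> Lft (length \<Upsilon>) (Ctr A) p \<triangleright> \<Upsilon> @ Bang A # \<Upsilon>' \<turnstile> C"
| ctr_wk: "p \<triangleright> \<Upsilon> @ Bang A # \<Upsilon>' \<turnstile> C \<Longrightarrow>
    Lft (length \<Upsilon>) (Ctr A) (Lft (length \<Upsilon>) (Wk A) p) \<approx> p \<triangleright> \<Upsilon> @ Bang A # \<Upsilon>' \<turnstile> C"

  (* Only the permutation effected by exchanges matters, and the place where they and the other
     rules on hypotheses are applied does not; ex_natural with \<rho> an exchange is the braid relation. *)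
| ex_ex: "p \<triangleright> \<Upsilon> @ A # B # \<Upsilon>' \<turnstile> C \<Longrightarrow>
    Lft (length \<Upsilon>) (Exch B A) (Lft (length \<Upsilon>) (Exch A B) p) \<approx> p \<triangleright> \<Upsilon> @ A # B # \<Upsilon>' \<turnstile> C"
| ex_natural: "p \<triangleright> \<Upsilon> @ B # prem \<rho> @ \<Upsilon>' \<turnstile> C \<Longrightarrow>
    ex_right (length \<Upsilon>) B (concl \<rho>) (Lft (length \<Upsilon> + 1) \<rho> p)
      \<approx> Lft (length \<Upsilon>) \<rho> (ex_right (length \<Upsilon>) B (prem \<rho>) p)
      \<triangleright> \<Upsilon> @ concl \<rho> @ B # \<Upsilon>' \<turnstile> C"
| lft_lft: "p \<triangleright> \<Upsilon> @ prem \<rho> @ \<Upsilon>' @ prem \<rho>' @ \<Upsilon>'' \<turnstile> C \<Longrightarrow>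
    Lft (length \<Upsilon>) \<rho> (Lft (length \<Upsilon> + length (prem \<rho>) + length \<Upsilon>') \<rho>' p)
      \<approx> Lft (length \<Upsilon> + length (concl \<rho>) + length \<Upsilon>') \<rho>' (Lft (length \<Upsilon>) \<rho> p)
      \<triangleright> \<Upsilon> @ concl \<rho> @ \<Upsilon>' @ concl \<rho>' @ \<Upsilon>'' \<turnstile> C"

section \<open>Iterated tensor products\<close>

text \<open>\<open>A\<^sub>1 \<otimes> A\<^sub>2 \<otimes> \<dots> \<otimes> A\<^sub>r\<close> (for \<open>r \<ge> 1\<close>) is read as \<open>(\<dots>(A\<^sub>1 \<otimes> A\<^sub>2) \<otimes> \<dots>) \<otimes> A\<^sub>r\<close>.\<close>

definition tens :: "'v fm list \<Rightarrow> 'v fm" where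
  "tens As = foldl Tens (hd As) (tl As)"

definition tens_prf :: "'v derivation list \<Rightarrow> 'v derivation" where
  "tens_prf ps = foldl TensR (hd ps) (tl ps)"

text \<open>The identification of the proofs of \<open>A\<^sub>1, \<dots>, A\<^sub>r \<turnstile> C\<close> with those of \<open>A\<^sub>1 \<otimes> \<dots> \<otimes> A\<^sub>r \<turnstile> C\<close>.\<close>

fun tensL_from :: "'v fm \<Rightarrow> 'v fm list \<Rightarrow> 'v derivation \<Rightarrow> 'v derivation" where
  "tensL_from A [] p = p"
| "tensL_from A (B # Bs) p = tensL_from (Tens A B) Bs (Lft 0 (TensL A B) p)"

definition tensL :: "'v fm list \<Rightarrow> 'v derivation \<Rightarrow> 'v derivation" where
  "tensL As p = tensL_from (hd As) (tl As) p"

section \<open>Plain proofs\<close>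

fun der_from :: "nat \<Rightarrow> 'v fm list \<Rightarrow> 'v derivation \<Rightarrow> 'v derivation" where
  "der_from i [] p = p"
| "der_from i (A # \<Gamma>) p = der_from (Suc i) \<Gamma> (Lft i (Der A) p)"

definition merge :: "nat \<Rightarrow> 'v fm \<Rightarrow> nat \<Rightarrow> 'v derivation \<Rightarrow> 'v derivation" where
  "merge i A n p = (if n = 0 then Lft i (Wk A) p else (Lft i (Ctr A) ^^ (n - 1)) p)"

text \<open>Turns \<open>\<Upsilon>, n\<^sub>1 !A\<^sub>1, \<dots>, n\<^sub>r !A\<^sub>r \<turnstile> B\<close> into \<open>\<Upsilon>, !A\<^sub>1, \<dots>, !A\<^sub>r \<turnstile> B\<close>; \<open>i\<close> is the length of \<open>\<Upsilon>\<close>.\<close>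

fun merge_from :: "nat \<Rightarrow> 'v fm list \<Rightarrow> nat list \<Rightarrow> 'v derivation \<Rightarrow> 'v derivation" where
  "merge_from i (A # As) (n # ns) p = merge_from (Suc i) As ns (merge i A n p)"
| "merge_from i _ _ p = p"

definition copies :: "nat list \<Rightarrow> 'v fm list \<Rightarrow> 'v fm list" where
  "copies ns As = concat (map2 replicate ns As)"

definition plain :: "'v fm list \<Rightarrow> 'v fm \<Rightarrow> 'v derivation \<Rightarrow> bool" where
  "plain As B p \<longleftrightarrow>
     p \<triangleright> map Bang As \<turnstile> B \<and>
     (\<exists>ns \<pi>. length ns = length As \<and> \<pi> \<triangleright> copies ns As \<turnstile> B \<and>
        p \<approx> merge_from 0 As ns (der_from 0 (copies ns As) \<pi>) \<triangleright> map Bang As \<turnstile> B)"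

text \<open>The hypotheses of \<open>tens_prf (map Prom \<psi>s)\<close> are \<open>t\<close> consecutive blocks \<open>!A\<^sub>1, \<dots>, !A\<^sub>r\<close>, which
  \<open>t - 1\<close> contractions of blocks reduce to one.\<close>

definition cw_plain :: "'v fm list \<Rightarrow> 'v fm list \<Rightarrow> 'v derivation \<Rightarrow> bool" where
  "cw_plain As Bs \<psi> \<longleftrightarrow>
     Bs \<noteq> [] \<and> \<psi> \<triangleright> map Bang As \<turnstile> tens (map Bang Bs) \<and>
     (\<exists>\<psi>s. list_all2 (plain As) Bs \<psi>s \<and>
        \<psi> \<approx> (ctr_block 0 As ^^ (length Bs - 1)) (tens_prf (map Prom \<psi>s))
          \<triangleright> map Bang As \<turnstile> tens (map Bang Bs))"

text \<open>The same notion for proofs of \<open>!A\<^sub>1 \<otimes> \<dots> \<otimes> !A\<^sub>r \<turnstile> !B\<^sub>1 \<otimes> \<dots> \<otimes> !B\<^sub>t\<close>.\<close>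

definition cw_plain_tens :: "'v fm list \<Rightarrow> 'v fm list \<Rightarrow> 'v derivation \<Rightarrow> bool" where
  "cw_plain_tens As Bs \<phi> \<longleftrightarrow>
     As \<noteq> [] \<and> (\<exists>\<psi>. cw_plain As Bs \<psi> \<and>
       \<phi> \<approx> tensL (map Bang As) \<psi> \<triangleright> [tens (map Bang As)] \<turnstile> tens (map Bang Bs))"

section \<open>Booleans and Turing machines\<close>

text \<open>\<open>with_pow A m\<close> is \<open>A & (A & (\<dots> & A))\<close> with \<open>m\<close> factors; there is no unit for \<open>&\<close>, so \<open>m \<ge> 1\<close>.\<close>

fun with_pow :: "'v fm \<Rightarrow> nat \<Rightarrow> 'v fm" where
  "with_pow A (Suc 0) = A"
| "with_pow A (Suc (Suc m)) = With A (with_pow A (Suc m))"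

fun proj :: "'v fm \<Rightarrow> nat \<Rightarrow> nat \<Rightarrow> 'v derivation" where
  "proj A (Suc 0) _ = Ax A"
| "proj A (Suc (Suc m)) 0 = Lft 0 (WithL1 A (with_pow A (Suc m))) (Ax A)"
| "proj A (Suc (Suc m)) (Suc i) = Lft 0 (WithL2 A (with_pow A (Suc m))) (proj A (Suc m) i)"

definition boolean :: "'v fm \<Rightarrow> nat \<Rightarrow> 'v fm" where
  "boolean A m = Lol (with_pow A m) A"

definition boolean_prf :: "'v fm \<Rightarrow> nat \<Rightarrow> nat \<Rightarrow> 'v derivation" where
  "boolean_prf A m i = LolR (proj A m i)"

datatype dir = Left | Right

text \<open>The tape contents after the step in relative coordinates \<open>-h-1, \<dots>, h+1\<close>, where \<open>\<sigma>\<close> gives the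
  contents before it in relative coordinates \<open>-h, \<dots>, h\<close> and \<open>c\<close> is the symbol written.\<close>

fun step_tape :: "nat \<Rightarrow> (int \<Rightarrow> nat) \<Rightarrow> nat \<Rightarrow> dir \<Rightarrow> nat list" where
  "step_tape h \<sigma> c Left = [0, 0] @ map \<sigma> [- int h..-1] @ [c] @ map \<sigma> [1..int h]"
| "step_tape h \<sigma> c Right = map \<sigma> [- int h..-1] @ [c] @ map \<sigma> [1..int h] @ [0, 0]"

text \<open>\<open>prom(\<sigma>\<^sub>1) \<otimes> \<dots> \<otimes> prom(\<sigma>\<^sub>k) \<otimes> prom(q)\<close> for a list of symbols and a state.\<close>

definition config_prf :: "'v fm \<Rightarrow> nat \<Rightarrow> nat \<Rightarrow> nat list \<Rightarrow> nat \<Rightarrow> 'v derivation" where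
  "config_prf A s n \<sigma>s q =
     tens_prf (map (\<lambda>i. Prom (boolean_prf A s i)) \<sigma>s @ [Prom (boolean_prf A n q)])"

end

theory Submission
  imports Defs
begin

text \<open>
  Any function on tuples of booleans is computed by a proof that uses each argument exactly once:
  apply the last boolean to the tuple, over its possible values, of proofs deciding on the
  remaining ones. Derelicting all hypotheses of such a proof gives a plain proof, so any tuple of
  such functions is computed by a component-wise plain proof, and one step of the machine is a
  tuple of functions of the scanned window and the state. Since all proofs that are cut against it
  are closed promotions, no commutation leaves a residual context behind.
\<close>

section \<open>Cuts against closed proofs\<close>

text \<open>A boolean over \<open>A\<close> can only be eliminated into \<open>A\<close>, whereas
  each component has to produce a boolean. The output type is itself A^k -o A, so it is opened
  before any input is inspected: with A^k as an extra hypothesis the goal is \<open>A\<close>, every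
  input boolean can branch into it, and a leaf projects A^k onto the computed value. The nested case
  distinction stays linear because the right rule for & shares its context: all branches receive the
  same remaining hypotheses. A component also branches on arguments that do not influence it, with
  equal outcomes, so every multiplicity in its plainness witness is 1, and contraction occurs only
  between components. The main labour is bookkeeping. The equivalence relates trees whose rules act
  at numbered positions, so evaluation means moving a whole list of cuts through tensors, block
  contractions, promotions and derelictions while tracking how positions shift.\<close>

abbreviation closed_prfs :: "'v derivation list \<Rightarrow> 'v fm list \<Rightarrow> bool" where
  "closed_prfs \<equiv> list_all2 (\<lambda>p A. p \<triangleright> [] \<turnstile> A)"

text \<open>The head is the outermost cut, so the rightmost hypothesis is cut away before the
  others. A closed proof puts nothing in place of its hypothesis; hence the positions further left
  stay valid.\<close>

fun cuts :: "nat \<Rightarrow> 'v derivation list \<Rightarrow> 'v derivation \<Rightarrow> 'v derivation" where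
  "cuts i [] q = q"
| "cuts i (p # ps) q = Cut i p (cuts (Suc i) ps q)"

lemma cuts_append: "cuts i (ps @ rs) q = cuts i ps (cuts (i + length ps) rs q)"
  by (induction ps arbitrary: i) auto

lemma closed_cut:
  assumes "p \<triangleright> [] \<turnstile> A" "q \<triangleright> \<Upsilon> @ A # \<Upsilon>' \<turnstile> C"
  shows "Cut (length \<Upsilon>) p q \<triangleright> \<Upsilon> @ \<Upsilon>' \<turnstile> C"
  using proves.cut[OF assms] by simp

lemma closed_cut_cong:
  assumes "p \<triangleright> [] \<turnstile> A" "q \<approx> q' \<triangleright> \<Upsilon> @ A # \<Upsilon>' \<turnstile> C"
  shows "Cut (length \<Upsilon>) p q \<approx> Cut (length \<Upsilon>) p q' \<triangleright> \<Upsilon> @ \<Upsilon>' \<turnstile> C"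
  using cong_cut[OF equiv_refl[OF assms(1)] assms(2)] by simp

text \<open>This induction pattern recurs below: the tail is cut while the hypothesis of the head is
  still present, so the induction hypothesis is used at \<open>\<Upsilon> @ [A]\<close> and the left
  context must be arbitrary.\<close>

lemma cuts_proves:
  assumes "closed_prfs ps As" "q \<triangleright> \<Upsilon> @ As @ \<Upsilon>' \<turnstile> C"
  shows "cuts (length \<Upsilon>) ps q \<triangleright> \<Upsilon> @ \<Upsilon>' \<turnstile> C"
  using assms
proof (induction arbitrary: \<Upsilon> rule: list_all2_induct)
  case (Cons p ps A As)
  then have "cuts (Suc (length \<Upsilon>)) ps q \<triangleright> \<Upsilon> @ A # \<Upsilon>' \<turnstile> C"
    using Cons.IH[of "\<Upsilon> @ [A]"] by simp
  with Cons.hyps show ?case by (simp add: closed_cut)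
qed simp

lemma cuts_cong:
  assumes "closed_prfs ps As" "q \<approx> q' \<triangleright> \<Upsilon> @ As @ \<Upsilon>' \<turnstile> C"
  shows "cuts (length \<Upsilon>) ps q \<approx> cuts (length \<Upsilon>) ps q' \<triangleright> \<Upsilon> @ \<Upsilon>' \<turnstile> C"
  using assms
proof (induction arbitrary: \<Upsilon> rule: list_all2_induct)
  case (Cons p ps A As)
  then have "cuts (Suc (length \<Upsilon>)) ps q \<approx> cuts (Suc (length \<Upsilon>)) ps q' \<triangleright> \<Upsilon> @ A # \<Upsilon>' \<turnstile> C"
    using Cons.IH[of "\<Upsilon> @ [A]"] by simp
  with Cons.hyps show ?case by (simp add: closed_cut_cong)
qed simp

section \<open>Moving closed cuts past the last rule of the right premise\<close>

text \<open>The rule acts to the left of all cut hypotheses, so passing it only shifts positions by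
  the difference in length between its two blocks. Here the gap \<open>\<Upsilon>'\<close> is
  arbitrary in the induction, since the hypothesis of the head joins it while the tail is
  cut.\<close>

lemma cuts_lft:
  assumes "closed_prfs ps As" "q \<triangleright> \<Upsilon> @ prem \<rho> @ \<Upsilon>' @ As @ \<Upsilon>'' \<turnstile> C"
  shows "cuts (length \<Upsilon> + length (concl \<rho>) + length \<Upsilon>') ps (Lft (length \<Upsilon>) \<rho> q)
    \<approx> Lft (length \<Upsilon>) \<rho> (cuts (length \<Upsilon> + length (prem \<rho>) + length \<Upsilon>') ps q)
    \<triangleright> \<Upsilon> @ concl \<rho> @ \<Upsilon>' @ \<Upsilon>'' \<turnstile> C"
  using assms
proof (induction arbitrary: \<Upsilon>' rule: list_all2_induct)
  case Nil
  then show ?case using equiv_refl[OF proves.lft[of q \<Upsilon> \<rho> "\<Upsilon>' @ \<Upsilon>''" C]] by simp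
next
  case (Cons p ps A As)
  let ?n = "length \<Upsilon> + length (concl \<rho>) + length \<Upsilon>'"
  let ?m = "length \<Upsilon> + length (prem \<rho>) + length \<Upsilon>'"
  have "Cut ?n p (cuts (Suc ?n) ps (Lft (length \<Upsilon>) \<rho> q))
      \<approx> Cut ?n p (Lft (length \<Upsilon>) \<rho> (cuts (Suc ?m) ps q)) \<triangleright> \<Upsilon> @ concl \<rho> @ \<Upsilon>' @ \<Upsilon>'' \<turnstile> C"
    using closed_cut_cong[OF Cons.hyps(1), of _ _ "\<Upsilon> @ concl \<rho> @ \<Upsilon>'" "\<Upsilon>''" C]
      Cons.IH[of "\<Upsilon>' @ [A]"] Cons.prems by (simp add: add.assoc)
  moreover have "cuts (Suc ?m) ps q \<triangleright> \<Upsilon> @ prem \<rho> @ \<Upsilon>' @ A # \<Upsilon>'' \<turnstile> C"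
    using cuts_proves[OF Cons.hyps(2), of q "\<Upsilon> @ prem \<rho> @ \<Upsilon>' @ [A]"] Cons.prems
    by (simp add: add.assoc)
  from right_lft_before[OF Cons.hyps(1) this]
  have "Cut ?n p (Lft (length \<Upsilon>) \<rho> (cuts (Suc ?m) ps q))
      \<approx> Lft (length \<Upsilon>) \<rho> (Cut ?m p (cuts (Suc ?m) ps q)) \<triangleright> \<Upsilon> @ concl \<rho> @ \<Upsilon>' @ \<Upsilon>'' \<turnstile> C"
    by simp
  ultimately show ?case by (simp add: equiv_trans)
qed

lemma cuts_tensR_left:
  assumes "closed_prfs ps As" "q \<triangleright> \<Upsilon> @ As @ \<Upsilon>' \<turnstile> B" "r \<triangleright> \<Delta> \<turnstile> C"
  shows "cuts (length \<Upsilon>) ps (TensR q r) \<approx> TensR (cuts (length \<Upsilon>) ps q) r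
    \<triangleright> \<Upsilon> @ \<Upsilon>' @ \<Delta> \<turnstile> Tens B C"
  using assms
proof (induction arbitrary: \<Upsilon> rule: list_all2_induct)
  case Nil
  then show ?case using equiv_refl[OF proves.tensR] by fastforce
next
  case (Cons p ps A As)
  have "Cut (length \<Upsilon>) p (cuts (Suc (length \<Upsilon>)) ps (TensR q r))
      \<approx> Cut (length \<Upsilon>) p (TensR (cuts (Suc (length \<Upsilon>)) ps q) r) \<triangleright> \<Upsilon> @ \<Upsilon>' @ \<Delta> \<turnstile> Tens B C"
    using closed_cut_cong[OF Cons.hyps(1)] Cons.IH[of "\<Upsilon> @ [A]"] Cons.prems by simp
  moreover have "cuts (Suc (length \<Upsilon>)) ps q \<triangleright> \<Upsilon> @ A # \<Upsilon>' \<turnstile> B"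
    using cuts_proves[OF Cons.hyps(2), of q "\<Upsilon> @ [A]"] Cons.prems by simp
  from right_tensR1[OF Cons.hyps(1) this Cons.prems(2)]
  have "Cut (length \<Upsilon>) p (TensR (cuts (Suc (length \<Upsilon>)) ps q) r)
      \<approx> TensR (Cut (length \<Upsilon>) p (cuts (Suc (length \<Upsilon>)) ps q)) r \<triangleright> \<Upsilon> @ \<Upsilon>' @ \<Delta> \<turnstile> Tens B C"
    by simp
  ultimately show ?case by (simp add: equiv_trans)
qed

lemma cuts_tensR_right:
  assumes "closed_prfs ps As" "q \<triangleright> \<Delta> \<turnstile> B" "r \<triangleright> \<Upsilon> @ As @ \<Upsilon>' \<turnstile> C"
  shows "cuts (length \<Delta> + length \<Upsilon>) ps (TensR q r) \<approx> TensR q (cuts (length \<Upsilon>) ps r)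
    \<triangleright> \<Delta> @ \<Upsilon> @ \<Upsilon>' \<turnstile> Tens B C"
  using assms
proof (induction arbitrary: \<Upsilon> rule: list_all2_induct)
  case Nil
  then show ?case using equiv_refl[OF proves.tensR] by fastforce
next
  case (Cons p ps A As)
  let ?n = "length \<Delta> + length \<Upsilon>"
  have "Cut ?n p (cuts (Suc ?n) ps (TensR q r))
      \<approx> Cut ?n p (TensR q (cuts (Suc (length \<Upsilon>)) ps r)) \<triangleright> \<Delta> @ \<Upsilon> @ \<Upsilon>' \<turnstile> Tens B C"
    using closed_cut_cong[OF Cons.hyps(1), of _ _ "\<Delta> @ \<Upsilon>"] Cons.IH[of "\<Upsilon> @ [A]"] Cons.prems
    by simp
  moreover have "cuts (Suc (length \<Upsilon>)) ps r \<triangleright> \<Upsilon> @ A # \<Upsilon>' \<turnstile> C"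
    using cuts_proves[OF Cons.hyps(2), of r "\<Upsilon> @ [A]"] Cons.prems by simp
  from right_tensR2[OF Cons.hyps(1) Cons.prems(1) this]
  have "Cut ?n p (TensR q (cuts (Suc (length \<Upsilon>)) ps r))
      \<approx> TensR q (Cut (length \<Upsilon>) p (cuts (Suc (length \<Upsilon>)) ps r)) \<triangleright> \<Delta> @ \<Upsilon> @ \<Upsilon>' \<turnstile> Tens B C"
    by simp
  ultimately show ?case by (simp add: equiv_trans)
qed

text \<open>The cuts with \<open>rs\<close> are the inner ones and enter the right factor while
  \<open>As\<close> is still in place. This leaves the right factor without hypotheses, and the cuts
  with \<open>ps\<close> then close the left one.\<close>

lemma cuts_tensR:
  assumes "closed_prfs ps As" "closed_prfs rs Bs" "q \<triangleright> As \<turnstile> B" "r \<triangleright> Bs \<turnstile> C"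
  shows "cuts 0 (ps @ rs) (TensR q r) \<approx> TensR (cuts 0 ps q) (cuts 0 rs r) \<triangleright> [] \<turnstile> Tens B C"
proof -
  have len: "length ps = length As" using assms(1) by (rule list_all2_lengthD)
  have "cuts (length ps) rs (TensR q r) \<approx> TensR q (cuts 0 rs r) \<triangleright> As \<turnstile> Tens B C"
    using cuts_tensR_right[OF assms(2,3), of r "[]" "[]"] assms(4) len by simp
  then have "cuts 0 ps (cuts (length ps) rs (TensR q r)) \<approx> cuts 0 ps (TensR q (cuts 0 rs r))
      \<triangleright> [] \<turnstile> Tens B C"
    using cuts_cong[OF assms(1), of _ _ "[]" "[]"] by simp
  moreover have "cuts 0 rs r \<triangleright> [] \<turnstile> C"
    using cuts_proves[OF assms(2), of r "[]" "[]"] assms(4) by simp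
  with cuts_tensR_left[OF assms(1), of q "[]" "[]" B "cuts 0 rs r" "[]" C] assms(3)
  have "cuts 0 ps (TensR q (cuts 0 rs r)) \<approx> TensR (cuts 0 ps q) (cuts 0 rs r) \<triangleright> [] \<turnstile> Tens B C"
    by simp
  ultimately show ?thesis by (simp add: cuts_append equiv_trans)
qed

text \<open>The hypothesis discharged by \<open>LolR\<close> stands in front in the premise, so
  under the rule every cut sits one place further right.\<close>

lemma cuts_lolR:
  assumes "closed_prfs ps As" "q \<triangleright> B # \<Upsilon> @ As @ \<Upsilon>' \<turnstile> C"
  shows "cuts (length \<Upsilon>) ps (LolR q) \<approx> LolR (cuts (Suc (length \<Upsilon>)) ps q) \<triangleright> \<Upsilon> @ \<Upsilon>' \<turnstile> Lol B C"
  using assms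
proof (induction arbitrary: \<Upsilon> rule: list_all2_induct)
  case Nil
  then show ?case using equiv_refl[OF proves.lolR] by fastforce
next
  case (Cons p ps A As)
  let ?n = "length \<Upsilon>"
  have "Cut ?n p (cuts (Suc ?n) ps (LolR q))
      \<approx> Cut ?n p (LolR (cuts (Suc (Suc ?n)) ps q)) \<triangleright> \<Upsilon> @ \<Upsilon>' \<turnstile> Lol B C"
    using closed_cut_cong[OF Cons.hyps(1)] Cons.IH[of "\<Upsilon> @ [A]"] Cons.prems by simp
  moreover have "cuts (Suc (Suc ?n)) ps q \<triangleright> B # \<Upsilon> @ A # \<Upsilon>' \<turnstile> C"
    using cuts_proves[OF Cons.hyps(2), of q "B # \<Upsilon> @ [A]"] Cons.prems by simp
  from right_lolR[OF Cons.hyps(1) this]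
  have "Cut ?n p (LolR (cuts (Suc (Suc ?n)) ps q))
      \<approx> LolR (Cut (Suc ?n) p (cuts (Suc (Suc ?n)) ps q)) \<triangleright> \<Upsilon> @ \<Upsilon>' \<turnstile> Lol B C"
    by simp
  ultimately show ?case by (simp add: equiv_trans)
qed

lemma closed_prfs_Prom:
  "closed_prfs vs As \<Longrightarrow> closed_prfs (map Prom vs) (map Bang As)"
  unfolding list_all2_map1 list_all2_map2
  by (erule list_all2_mono) (rule proves.prom[of _ "[]", simplified])

text \<open>A promotion can absorb a cut only if the proof cut in is itself a promotion and the side
  contexts are banged; the empty context of a closed proof counts as
  \<open>map Bang []\<close>.\<close>

lemma cuts_Prom:
  assumes "closed_prfs vs As" "q \<triangleright> map Bang \<Upsilon> @ map Bang As @ map Bang \<Upsilon>' \<turnstile> C"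
  shows "cuts (length \<Upsilon>) (map Prom vs) (Prom q) \<approx> Prom (cuts (length \<Upsilon>) (map Prom vs) q)
    \<triangleright> map Bang \<Upsilon> @ map Bang \<Upsilon>' \<turnstile> Bang C"
  using assms
proof (induction arbitrary: \<Upsilon> rule: list_all2_induct)
  case Nil
  then show ?case using equiv_refl[OF proves.prom[of q "\<Upsilon> @ \<Upsilon>'"]] by simp
next
  case (Cons p ps A As)
  let ?n = "length \<Upsilon>"
  have p: "p \<triangleright> map Bang [] \<turnstile> A" "Prom p \<triangleright> [] \<turnstile> Bang A"
    using Cons.hyps(1) proves.prom[of p "[]"] by simp_all
  have "Cut ?n (Prom p) (cuts (Suc ?n) (map Prom ps) (Prom q))
      \<approx> Cut ?n (Prom p) (Prom (cuts (Suc ?n) (map Prom ps) q))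
      \<triangleright> map Bang \<Upsilon> @ map Bang \<Upsilon>' \<turnstile> Bang C"
    using closed_cut_cong[OF p(2), of _ _ "map Bang \<Upsilon>"] Cons.IH[of "\<Upsilon> @ [A]"] Cons.prems by simp
  moreover have "cuts (Suc ?n) (map Prom ps) q \<triangleright> map Bang \<Upsilon> @ Bang A # map Bang \<Upsilon>' \<turnstile> C"
    using cuts_proves[OF closed_prfs_Prom[OF Cons.hyps(2)], of q "map Bang \<Upsilon> @ [Bang A]"]
      Cons.prems by simp
  from cut_prom_prom[OF p(1) this]
  have "Cut ?n (Prom p) (Prom (cuts (Suc ?n) (map Prom ps) q))
      \<approx> Prom (Cut ?n (Prom p) (cuts (Suc ?n) (map Prom ps) q))
      \<triangleright> map Bang \<Upsilon> @ map Bang \<Upsilon>' \<turnstile> Bang C"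
    by simp
  ultimately show ?case by (simp add: equiv_trans)
qed

text \<open>\<open>der_from\<close> derelicts the head innermost, whereas its cut is outermost. So
  the tail is settled by the induction hypothesis for \<open>Lft ?n (Der A) q\<close>, its now
  unpromoted cuts are commuted past the dereliction of the head, and only then do promotion and
  dereliction of the head meet.\<close>

lemma cuts_der_from:
  assumes "closed_prfs vs As" "q \<triangleright> \<Upsilon> @ As @ \<Upsilon>' \<turnstile> C"
  shows "cuts (length \<Upsilon>) (map Prom vs) (der_from (length \<Upsilon>) As q) \<approx> cuts (length \<Upsilon>) vs q
    \<triangleright> \<Upsilon> @ \<Upsilon>' \<turnstile> C"
  using assms
proof (induction arbitrary: \<Upsilon> q rule: list_all2_induct)
  case Nil
  then show ?case using equiv_refl by fastforce
next
  case (Cons p ps A As)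
  let ?n = "length \<Upsilon>"
  have p: "p \<triangleright> map Bang [] \<turnstile> A" "Prom p \<triangleright> [] \<turnstile> Bang A"
    using Cons.hyps(1) proves.prom[of p "[]"] by simp_all
  have "Lft ?n (Der A) q \<triangleright> \<Upsilon> @ Bang A # As @ \<Upsilon>' \<turnstile> C"
    using proves.lft[of q \<Upsilon> "Der A"] Cons.prems by simp
  then have "cuts (Suc ?n) (map Prom ps) (der_from (Suc ?n) As (Lft ?n (Der A) q))
      \<approx> cuts (Suc ?n) ps (Lft ?n (Der A) q) \<triangleright> \<Upsilon> @ Bang A # \<Upsilon>' \<turnstile> C"
    using Cons.IH[of "Lft ?n (Der A) q" "\<Upsilon> @ [Bang A]"] by simp
  moreover have "cuts (Suc ?n) ps (Lft ?n (Der A) q) \<approx> Lft ?n (Der A) (cuts (Suc ?n) ps q)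
      \<triangleright> \<Upsilon> @ Bang A # \<Upsilon>' \<turnstile> C"
    using cuts_lft[OF Cons.hyps(2), of q \<Upsilon> "Der A" "[]"] Cons.prems by simp
  ultimately have "cuts (Suc ?n) (map Prom ps) (der_from (Suc ?n) As (Lft ?n (Der A) q))
      \<approx> Lft ?n (Der A) (cuts (Suc ?n) ps q) \<triangleright> \<Upsilon> @ Bang A # \<Upsilon>' \<turnstile> C"
    by (rule equiv_trans)
  note closed_cut_cong[OF p(2) this]
  moreover have "cuts (Suc ?n) ps q \<triangleright> \<Upsilon> @ A # \<Upsilon>' \<turnstile> C"
    using cuts_proves[OF Cons.hyps(2), of q "\<Upsilon> @ [A]"] Cons.prems by simp
  from cut_prom_der[OF p(1) this]
  have "Cut ?n (Prom p) (Lft ?n (Der A) (cuts (Suc ?n) ps q))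
      \<approx> Cut ?n p (cuts (Suc ?n) ps q) \<triangleright> \<Upsilon> @ \<Upsilon>' \<turnstile> C"
    by simp
  ultimately show ?case by (simp add: equiv_trans)
qed

section \<open>Exchanges and block contractions against closed proofs\<close>

lemma ex_left_proves:
  assumes "q \<triangleright> \<Upsilon> @ \<Gamma> @ A # \<Upsilon>' \<turnstile> C"
  shows "ex_left (length \<Upsilon>) \<Gamma> A q \<triangleright> \<Upsilon> @ A # \<Gamma> @ \<Upsilon>' \<turnstile> C"
  using assms
proof (induction \<Gamma> arbitrary: \<Upsilon>)
  case (Cons D \<Gamma>)
  then have "ex_left (Suc (length \<Upsilon>)) \<Gamma> A q \<triangleright> \<Upsilon> @ prem (Exch D A) @ \<Gamma> @ \<Upsilon>' \<turnstile> C"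
    using Cons.IH[of "\<Upsilon> @ [D]"] by simp
  from proves.lft[OF this] show ?case by simp
qed simp

lemma ctr_block_proves:
  assumes "q \<triangleright> \<Upsilon> @ map Bang As @ map Bang As @ \<Upsilon>' \<turnstile> C"
  shows "ctr_block (length \<Upsilon>) As q \<triangleright> \<Upsilon> @ map Bang As @ \<Upsilon>' \<turnstile> C"
  using assms
proof (induction As arbitrary: \<Upsilon> q)
  case (Cons A As)
  have "ex_left (Suc (length \<Upsilon>)) (map Bang As) (Bang A) q
      \<triangleright> \<Upsilon> @ prem (Ctr A) @ map Bang As @ map Bang As @ \<Upsilon>' \<turnstile> C"
    using ex_left_proves[of q "\<Upsilon> @ [Bang A]" "map Bang As" "Bang A"] Cons.prems by simp
  from proves.lft[OF this] show ?case using Cons.IH[of _ "\<Upsilon> @ [Bang A]"] by simp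
qed simp

text \<open>Against closed proofs an exchange merely reorders the cuts. The extra proofs
  \<open>rs\<close> are carried along because their cuts lie inside the others and have to pass the
  same exchanges.\<close>

lemma cuts_ex_left:
  assumes "closed_prfs ps \<Gamma>" "p \<triangleright> [] \<turnstile> A" "closed_prfs rs \<Delta>" "q \<triangleright> \<Upsilon> @ \<Gamma> @ A # \<Delta> @ \<Upsilon>' \<turnstile> C"
  shows "cuts (length \<Upsilon>) (p # ps @ rs) (ex_left (length \<Upsilon>) \<Gamma> A q)
    \<approx> cuts (length \<Upsilon>) (ps @ p # rs) q \<triangleright> \<Upsilon> @ \<Upsilon>' \<turnstile> C"
  using assms
proof (induction arbitrary: \<Upsilon> rule: list_all2_induct)
  case Nil
  then show ?case
    using equiv_refl[OF cuts_proves[of "p # rs" "A # \<Delta>" q \<Upsilon> \<Upsilon>' C]] by simp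
next
  case (Cons p' ps D \<Gamma>)
  let ?n = "length \<Upsilon>"
  define X where "X = ex_left (Suc ?n) \<Gamma> A q"
  define Z where "Z = cuts (Suc (Suc ?n)) (ps @ rs) X"
  have cl: "closed_prfs (ps @ rs) (\<Gamma> @ \<Delta>)"
    using Cons by (intro list_all2_appendI)
  have X: "X \<triangleright> \<Upsilon> @ D # A # (\<Gamma> @ \<Delta>) @ \<Upsilon>' \<turnstile> C"
    using ex_left_proves[of q "\<Upsilon> @ [D]" \<Gamma> A] Cons.prems unfolding X_def by simp
  have Z: "Z \<triangleright> \<Upsilon> @ D # A # \<Upsilon>' \<turnstile> C"
    using cuts_proves[OF cl, of X "\<Upsilon> @ [D, A]"] X unfolding Z_def by simp
  have "cuts (Suc (Suc ?n)) (ps @ rs) (Lft ?n (Exch D A) X)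
      \<approx> Lft ?n (Exch D A) Z \<triangleright> \<Upsilon> @ A # D # \<Upsilon>' \<turnstile> C"
    using cuts_lft[OF cl, of X \<Upsilon> "Exch D A" "[]"] X unfolding Z_def by simp
  then have 1: "Cut (Suc ?n) p' (cuts (Suc (Suc ?n)) (ps @ rs) (Lft ?n (Exch D A) X))
      \<approx> Cut (Suc ?n) p' (Lft ?n (Exch D A) Z) \<triangleright> \<Upsilon> @ A # \<Upsilon>' \<turnstile> C"
    using closed_cut_cong[OF Cons.hyps(1), of _ _ "\<Upsilon> @ [A]"] by simp
  \<comment> \<open>The exchange disappears here: \<open>cut_ex_left\<close> leaves one exchange per
    hypothesis of \<open>p'\<close>, and there is none.\<close>
  have 2: "Cut (Suc ?n) p' (Lft ?n (Exch D A) Z) \<approx> Cut ?n p' Z \<triangleright> \<Upsilon> @ A # \<Upsilon>' \<turnstile> C"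
    using cut_ex_left[OF Cons.hyps(1) Z] by simp
  have "Cut ?n p (Cut (Suc ?n) p' (cuts (Suc (Suc ?n)) (ps @ rs) (Lft ?n (Exch D A) X)))
      \<approx> Cut ?n p (Cut ?n p' Z) \<triangleright> \<Upsilon> @ \<Upsilon>' \<turnstile> C"
    using 1 2 by (rule closed_cut_cong[OF Cons.prems(1) equiv_trans])
  \<comment> \<open>The two independent cuts trade places. The position for \<open>p\<close> becomes
    \<open>Suc ?n\<close>, as \<open>D\<close> is now still present when \<open>p\<close> is cut
    in.\<close>
  moreover have "Cut ?n p (Cut ?n p' Z) \<approx> Cut ?n p' (Cut (Suc ?n) p Z) \<triangleright> \<Upsilon> @ \<Upsilon>' \<turnstile> C"
    using equiv_sym[OF right_cut[OF Cons.hyps(1) Cons.prems(1), of Z \<Upsilon> "[]"]] Z by simp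
  moreover have "Cut (Suc ?n) p Z \<approx> cuts (Suc ?n) (ps @ p # rs) q \<triangleright> \<Upsilon> @ D # \<Upsilon>' \<turnstile> C"
    using Cons.IH[of "\<Upsilon> @ [D]"] Cons.prems unfolding X_def Z_def by simp
  note closed_cut_cong[OF Cons.hyps(1) this]
  ultimately have "Cut ?n p (Cut (Suc ?n) p' (cuts (Suc (Suc ?n)) (ps @ rs) (Lft ?n (Exch D A) X)))
      \<approx> Cut ?n p' (cuts (Suc ?n) (ps @ p # rs) q) \<triangleright> \<Upsilon> @ \<Upsilon>' \<turnstile> C"
    by (rule equiv_trans[OF equiv_trans])
  then show ?case unfolding X_def by simp
qed

text \<open>Contracting a block and feeding it values amounts to feeding the values to both copies.
  \<open>ctr_block\<close> moves the second copy of each formula next to the first before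
  contracting; \<open>cuts_ex_left\<close> undoes this move on the list of cuts. The proofs
  \<open>rs\<close> stand for blocks not yet contracted.\<close>

lemma cuts_ctr_block:
  assumes "closed_prfs vs As" "closed_prfs rs \<Delta>"
    "q \<triangleright> \<Upsilon> @ map Bang As @ map Bang As @ \<Delta> @ \<Upsilon>' \<turnstile> C"
  shows "cuts (length \<Upsilon>) (map Prom vs @ rs) (ctr_block (length \<Upsilon>) As q)
    \<approx> cuts (length \<Upsilon>) (map Prom vs @ map Prom vs @ rs) q \<triangleright> \<Upsilon> @ \<Upsilon>' \<turnstile> C"
  using assms
proof (induction arbitrary: \<Upsilon> q rule: list_all2_induct)
  case Nil
  then show ?case using equiv_refl[OF cuts_proves[of rs \<Delta> q \<Upsilon> \<Upsilon>' C]] by simp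
next
  case (Cons v vs A As)
  let ?n = "length \<Upsilon>"
  let ?P = "map Prom vs" and ?A = "map Bang As"
  have v: "v \<triangleright> map Bang [] \<turnstile> A" "Prom v \<triangleright> [] \<turnstile> Bang A"
    using Cons.hyps(1) proves.prom[of v "[]"] by simp_all
  have cl: "closed_prfs (?P @ rs) (?A @ \<Delta>)" "closed_prfs (?P @ ?P @ rs) (?A @ ?A @ \<Delta>)"
    using closed_prfs_Prom[OF Cons.hyps(2)] Cons.prems by (simp_all add: list_all2_appendI)
  define X where "X = ex_left (Suc ?n) ?A (Bang A) q"
  define Z where "Z = cuts (Suc (Suc ?n)) (?P @ ?P @ rs) X"
  have X: "X \<triangleright> \<Upsilon> @ Bang A # Bang A # ?A @ ?A @ \<Delta> @ \<Upsilon>' \<turnstile> C"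
    using ex_left_proves[of q "\<Upsilon> @ [Bang A]" ?A "Bang A"] Cons.prems unfolding X_def by simp
  have Z: "Z \<triangleright> \<Upsilon> @ Bang A # Bang A # \<Upsilon>' \<turnstile> C"
    using cuts_proves[OF cl(2), of X "\<Upsilon> @ [Bang A, Bang A]"] X unfolding Z_def by simp
  have "Lft ?n (Ctr A) X \<triangleright> \<Upsilon> @ Bang A # ?A @ ?A @ \<Delta> @ \<Upsilon>' \<turnstile> C"
    using proves.lft[of X \<Upsilon> "Ctr A"] X by simp
  then have "cuts (Suc ?n) (?P @ rs) (ctr_block (Suc ?n) As (Lft ?n (Ctr A) X))
      \<approx> cuts (Suc ?n) (?P @ ?P @ rs) (Lft ?n (Ctr A) X) \<triangleright> \<Upsilon> @ Bang A # \<Upsilon>' \<turnstile> C"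
    using Cons.IH[of "Lft ?n (Ctr A) X" "\<Upsilon> @ [Bang A]"] Cons.prems by simp
  moreover have "cuts (Suc ?n) (?P @ ?P @ rs) (Lft ?n (Ctr A) X) \<approx> Lft ?n (Ctr A) Z
      \<triangleright> \<Upsilon> @ Bang A # \<Upsilon>' \<turnstile> C"
    using cuts_lft[OF cl(2), of X \<Upsilon> "Ctr A" "[]"] X unfolding Z_def by simp
  ultimately have "Cut ?n (Prom v) (cuts (Suc ?n) (?P @ rs) (ctr_block (Suc ?n) As (Lft ?n (Ctr A) X)))
      \<approx> Cut ?n (Prom v) (Lft ?n (Ctr A) Z) \<triangleright> \<Upsilon> @ \<Upsilon>' \<turnstile> C"
    by (rule closed_cut_cong[OF v(2) equiv_trans])
  \<comment> \<open>Duplicating \<open>Prom v\<close> would require contracting its context again,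
    but that context is \<open>map Bang []\<close>, so the resulting \<open>ctr_block\<close> is the
    identity.\<close>
  moreover have "Cut ?n (Prom v) (Lft ?n (Ctr A) Z)
      \<approx> Cut ?n (Prom v) (Cut (Suc ?n) (Prom v) Z) \<triangleright> \<Upsilon> @ \<Upsilon>' \<turnstile> C"
    using cut_prom_ctr[OF v(1) Z] by simp
  moreover have "Cut (Suc ?n) (Prom v) Z
      \<approx> cuts (Suc ?n) (?P @ Prom v # ?P @ rs) q \<triangleright> \<Upsilon> @ Bang A # \<Upsilon>' \<turnstile> C"
    using cuts_ex_left[OF closed_prfs_Prom[OF Cons.hyps(2)] v(2) cl(1), of q "\<Upsilon> @ [Bang A]"]
      Cons.prems unfolding X_def Z_def by simp
  note closed_cut_cong[OF v(2) this]
  ultimately have "Cut ?n (Prom v) (cuts (Suc ?n) (?P @ rs) (ctr_block (Suc ?n) As (Lft ?n (Ctr A) X)))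
      \<approx> Cut ?n (Prom v) (cuts (Suc ?n) (?P @ Prom v # ?P @ rs) q) \<triangleright> \<Upsilon> @ \<Upsilon>' \<turnstile> C"
    by (rule equiv_trans[OF equiv_trans])
  then show ?case unfolding X_def by simp
qed

lemma closed_prfs_blocks:
  "closed_prfs vs As \<Longrightarrow> closed_prfs (concat (replicate t (map Prom vs))) (concat (replicate t (map Bang As)))"
  by (induction t) (auto intro: list_all2_appendI dest: closed_prfs_Prom)

lemma funpow_ctr_block_proves:
  assumes "q \<triangleright> concat (replicate (Suc t) (map Bang As)) \<turnstile> C"
  shows "(ctr_block 0 As ^^ t) q \<triangleright> map Bang As \<turnstile> C"
  using assms
proof (induction t arbitrary: q)
  case (Suc t)
  then have "ctr_block 0 As q \<triangleright> concat (replicate (Suc t) (map Bang As)) \<turnstile> C"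
    using ctr_block_proves[of q "[]" As "concat (replicate t (map Bang As))" C] by simp
  from Suc.IH[OF this] show ?case by (simp add: funpow_swap1)
qed simp

lemma cuts_funpow_ctr_block:
  assumes "closed_prfs vs As" "q \<triangleright> concat (replicate (Suc t) (map Bang As)) \<turnstile> C"
  shows "cuts 0 (map Prom vs) ((ctr_block 0 As ^^ t) q)
    \<approx> cuts 0 (concat (replicate (Suc t) (map Prom vs))) q \<triangleright> [] \<turnstile> C"
  using assms(2)
proof (induction t arbitrary: q)
  case 0
  then show ?case
    using equiv_refl[OF cuts_proves[OF closed_prfs_Prom[OF assms(1)], of q "[]" "[]" C]] by simp
next
  case (Suc t)
  then have "ctr_block 0 As q \<triangleright> concat (replicate (Suc t) (map Bang As)) \<turnstile> C"
    using ctr_block_proves[of q "[]" As "concat (replicate t (map Bang As))" C] by simp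
  note Suc.IH[OF this]
  \<comment> \<open>Only the leading two blocks are contracted; the other \<open>t\<close> blocks
    are the \<open>rs\<close> of \<open>cuts_ctr_block\<close>.\<close>
  moreover have "cuts 0 (concat (replicate (Suc t) (map Prom vs))) (ctr_block 0 As q)
      \<approx> cuts 0 (concat (replicate (Suc (Suc t)) (map Prom vs))) q \<triangleright> [] \<turnstile> C"
    using cuts_ctr_block[OF assms(1) closed_prfs_blocks[OF assms(1), of t], of q "[]" "[]" C]
      Suc.prems by simp
  ultimately have "cuts 0 (map Prom vs) ((ctr_block 0 As ^^ t) (ctr_block 0 As q))
      \<approx> cuts 0 (concat (replicate (Suc (Suc t)) (map Prom vs))) q \<triangleright> [] \<turnstile> C"
    by (rule equiv_trans)
  then show ?case by (simp add: funpow_swap1)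
qed

section \<open>Iterated tensor products\<close>

lemma tensL_from_proves:
  "q \<triangleright> A # Bs @ \<Upsilon>' \<turnstile> C \<Longrightarrow> tensL_from A Bs q \<triangleright> foldl Tens A Bs # \<Upsilon>' \<turnstile> C"
proof (induction Bs arbitrary: A q)
  case (Cons B Bs)
  then show ?case using proves.lft[of q "[]" "TensL A B" "Bs @ \<Upsilon>'"] by simp
qed simp

lemma foldl_tensR_proves:
  assumes "list_all2 (\<lambda>r D. r \<triangleright> \<Delta> \<turnstile> D) rs Ds" "q \<triangleright> \<Gamma> \<turnstile> B"
  shows "foldl TensR q rs \<triangleright> \<Gamma> @ concat (replicate (length rs) \<Delta>) \<turnstile> foldl Tens B Ds"
  using assms
proof (induction arbitrary: q B \<Gamma> rule: list_all2_induct)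
  case (Cons r rs D Ds)
  from Cons.IH[OF proves.tensR[OF Cons.prems Cons.hyps(1)]] show ?case by simp
qed simp

lemma foldl_tensR_cong:
  assumes "list_all2 (\<lambda>x D. f x \<approx> g x \<triangleright> [] \<turnstile> D) xs Ds" "p \<approx> q \<triangleright> [] \<turnstile> B"
  shows "foldl TensR p (map f xs) \<approx> foldl TensR q (map g xs) \<triangleright> [] \<turnstile> foldl Tens B Ds"
  using assms
proof (induction arbitrary: p q B rule: list_all2_induct)
  case (Cons x xs D Ds)
  from Cons.IH[OF cong_tensR[OF Cons.prems Cons.hyps(1), simplified]] show ?case by simp
qed simp

text \<open>Both folds associate to the left, so \<open>TensR p p'\<close> serves as a single closed
  proof of \<open>Tens A B\<close> in the induction hypothesis. The left rule for this pair is
  innermost; once the remaining cuts have been commuted past it, the principal tensor cut splits the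
  pair again.\<close>

lemma cut_tensL_from:
  assumes "closed_prfs ps Bs" "p \<triangleright> [] \<turnstile> A" "q \<triangleright> A # Bs @ \<Upsilon>' \<turnstile> C"
  shows "Cut 0 (foldl TensR p ps) (tensL_from A Bs q) \<approx> cuts 0 (p # ps) q \<triangleright> \<Upsilon>' \<turnstile> C"
  using assms
proof (induction arbitrary: p A q rule: list_all2_induct)
  case Nil
  then show ?case using equiv_refl[OF closed_cut[of p A q "[]"]] by simp
next
  case (Cons p' ps B Bs)
  have "TensR p p' \<triangleright> [] \<turnstile> Tens A B"
    using proves.tensR[OF Cons.prems(1) Cons.hyps(1)] by simp
  note t = this
  have "Lft 0 (TensL A B) q \<triangleright> Tens A B # Bs @ \<Upsilon>' \<turnstile> C"
    using proves.lft[of q "[]" "TensL A B"] Cons.prems by simp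
  note Cons.IH[OF t this]
  moreover have "cuts (Suc 0) ps (Lft 0 (TensL A B) q) \<approx> Lft 0 (TensL A B) (cuts 2 ps q)
      \<triangleright> Tens A B # \<Upsilon>' \<turnstile> C"
    using cuts_lft[OF Cons.hyps(2), of q "[]" "TensL A B" "[]"] Cons.prems
    by (simp add: numeral_2_eq_2)
  then have "cuts 0 (TensR p p' # ps) (Lft 0 (TensL A B) q)
      \<approx> Cut 0 (TensR p p') (Lft 0 (TensL A B) (cuts 2 ps q)) \<triangleright> \<Upsilon>' \<turnstile> C"
    using closed_cut_cong[OF t, of _ _ "[]"] by simp
  moreover have "cuts 2 ps q \<triangleright> A # B # \<Upsilon>' \<turnstile> C"
    using cuts_proves[OF Cons.hyps(2), of q "[A, B]"] Cons.prems by (simp add: numeral_2_eq_2)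
  then have "Cut 0 (TensR p p') (Lft 0 (TensL A B) (cuts 2 ps q)) \<approx> cuts 0 (p # p' # ps) q
      \<triangleright> \<Upsilon>' \<turnstile> C"
    using cut_tens[OF Cons.prems(1) Cons.hyps(1), of _ "[]"] by (simp add: numeral_2_eq_2)
  ultimately show ?case unfolding tensL_from.simps foldl.simps by (rule equiv_trans[OF equiv_trans])
qed

text \<open>The accumulator \<open>q\<close> collects the factors already processed, and
  \<open>ps'\<close> the cuts belonging to them; each step moves one more block \<open>ps\<close>
  into \<open>ps'\<close> and splits it off by \<open>cuts_tensR\<close>.\<close>

lemma cuts_foldl_tensR:
  assumes "list_all2 (\<lambda>r D. r \<triangleright> As \<turnstile> D) rs Ds" "closed_prfs ps As" "closed_prfs ps' \<Delta>" "q \<triangleright> \<Delta> \<turnstile> B"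
  shows "cuts 0 (ps' @ concat (replicate (length rs) ps)) (foldl TensR q rs)
    \<approx> foldl TensR (cuts 0 ps' q) (map (cuts 0 ps) rs) \<triangleright> [] \<turnstile> foldl Tens B Ds"
  using assms
proof (induction arbitrary: q B ps' \<Delta> rule: list_all2_induct)
  case Nil
  then show ?case using equiv_refl[OF cuts_proves[of ps' \<Delta> q "[]" "[]"]] by simp
next
  case (Cons r rs D Ds)
  have "cuts 0 ((ps' @ ps) @ concat (replicate (length rs) ps)) (foldl TensR (TensR q r) rs)
      \<approx> foldl TensR (cuts 0 (ps' @ ps) (TensR q r)) (map (cuts 0 ps) rs)
      \<triangleright> [] \<turnstile> foldl Tens (Tens B D) Ds"
    by (rule Cons.IH[OF Cons.prems(1) list_all2_appendI[OF Cons.prems(2,1)]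
        proves.tensR[OF Cons.prems(3) Cons.hyps(1)]])
  moreover have "list_all2 (\<lambda>r D. cuts 0 ps r \<approx> cuts 0 ps r \<triangleright> [] \<turnstile> D) rs Ds"
    using Cons.hyps(2)
  proof (rule list_all2_mono)
    fix r D assume "r \<triangleright> As \<turnstile> D"
    then show "cuts 0 ps r \<approx> cuts 0 ps r \<triangleright> [] \<turnstile> D"
      using cuts_proves[OF Cons.prems(1), of r "[]" "[]"] by (auto intro: equiv_refl)
  qed
  from foldl_tensR_cong[OF this cuts_tensR[OF Cons.prems(2,1,3) Cons.hyps(1)]]
  have "foldl TensR (cuts 0 (ps' @ ps) (TensR q r)) (map (cuts 0 ps) rs)
      \<approx> foldl TensR (TensR (cuts 0 ps' q) (cuts 0 ps r)) (map (cuts 0 ps) rs)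
      \<triangleright> [] \<turnstile> foldl Tens (Tens B D) Ds" .
  from equiv_trans[OF calculation this] show ?case by simp
qed

section \<open>Component-wise plain proofs\<close>

lemma der_from_proves:
  "q \<triangleright> \<Upsilon> @ As @ \<Upsilon>' \<turnstile> C \<Longrightarrow> der_from (length \<Upsilon>) As q \<triangleright> \<Upsilon> @ map Bang As @ \<Upsilon>' \<turnstile> C"
proof (induction As arbitrary: \<Upsilon> q)
  case (Cons A As)
  then show ?case
    using proves.lft[of q \<Upsilon> "Der A"] Cons.IH[of "Lft (length \<Upsilon>) (Der A) q" "\<Upsilon> @ [Bang A]"] by simp
qed simp

text \<open>The witness takes every multiplicity to be 1, for which \<open>copies\<close> gives back
  \<open>As\<close> and \<open>merge\<close> iterates contraction zero times.\<close>

lemma plain_der_from: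
  assumes "\<pi> \<triangleright> As \<turnstile> B"
  shows "plain As B (der_from 0 As \<pi>)"
proof -
  have copies: "copies (replicate (length As) (Suc 0)) As = As"
    by (induction As) (auto simp: copies_def)
  have merge: "merge_from i As (replicate (length As) (Suc 0)) q = q" for i and q :: "'a derivation"
    by (induction As arbitrary: i) (auto simp: merge_def)
  have typing: "der_from 0 As \<pi> \<triangleright> map Bang As \<turnstile> B"
    using der_from_proves[of \<pi> "[]" As "[]"] assms by simp
  show ?thesis
    unfolding plain_def
  proof (intro conjI exI)
    show "length (replicate (length As) (Suc 0)) = length As" by simp
    show "\<pi> \<triangleright> copies (replicate (length As) (Suc 0)) As \<turnstile> B" using assms by (simp only: copies)
    show "der_from 0 As \<pi> \<approx> merge_from 0 As (replicate (length As) (Suc 0))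
        (der_from 0 (copies (replicate (length As) (Suc 0)) As) \<pi>) \<triangleright> map Bang As \<turnstile> B"
      unfolding copies merge using typing by (rule equiv_refl)
  qed (rule typing)
qed

lemma list_all2_Prom_proves:
  "list_all2 (\<lambda>\<psi> B. \<psi> \<triangleright> map Bang As \<turnstile> B) \<psi>s Bs \<Longrightarrow>
    list_all2 (\<lambda>\<psi> B. \<psi> \<triangleright> map Bang As \<turnstile> B) (map Prom \<psi>s) (map Bang Bs)"
  unfolding list_all2_map1 list_all2_map2 by (erule list_all2_mono) (rule proves.prom)

text \<open>For nonempty \<open>Bs\<close> the number of blocks is just \<open>length Bs\<close>;
  the form \<open>Suc (length Bs - 1)\<close> fits the lemmas on \<open>length Bs - 1\<close>
  successive block contractions.\<close>

lemma tens_promotions_proves: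
  assumes "Bs \<noteq> []" "list_all2 (\<lambda>\<psi> B. \<psi> \<triangleright> map Bang As \<turnstile> B) \<psi>s Bs"
  shows "tens_prf (map Prom \<psi>s) \<triangleright> concat (replicate (Suc (length Bs - 1)) (map Bang As))
    \<turnstile> tens (map Bang Bs)"
proof -
  obtain \<psi> \<psi>s' B Bs' where eq: "\<psi>s = \<psi> # \<psi>s'" "Bs = B # Bs'"
    using assms by (cases \<psi>s; cases Bs) auto
  have "length \<psi>s' = length Bs'" using list_all2_lengthD[OF assms(2)] eq by simp
  moreover have "list_all2 (\<lambda>\<psi> B. \<psi> \<triangleright> map Bang As \<turnstile> B) (map Prom \<psi>s') (map Bang Bs')"
    "Prom \<psi> \<triangleright> map Bang As \<turnstile> Bang B"
    using list_all2_Prom_proves[OF assms(2)] eq by simp_all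
  note foldl_tensR_proves[OF this]
  ultimately show ?thesis unfolding tens_prf_def tens_def by (simp add: eq)
qed

lemma cw_plain_promotions:
  assumes "Bs \<noteq> []" "list_all2 (plain As) Bs \<psi>s"
  shows "cw_plain As Bs ((ctr_block 0 As ^^ (length Bs - 1)) (tens_prf (map Prom \<psi>s)))"
proof -
  have "list_all2 (\<lambda>\<psi> B. \<psi> \<triangleright> map Bang As \<turnstile> B) \<psi>s Bs"
    using assms(2) by (simp add: list_all2_conv_all_nth plain_def)
  from equiv_refl[OF funpow_ctr_block_proves[OF tens_promotions_proves[OF assms(1) this]]]
    funpow_ctr_block_proves[OF tens_promotions_proves[OF assms(1) this]]
  show ?thesis using assms unfolding cw_plain_def by blast
qed

text \<open>Evaluation of a component-wise plain proof on promoted values: the tensor of values is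
  unpacked, each contraction hands the values to one more component, the tensor of components
  separates the blocks, and every promotion takes its own cuts inside.\<close>

lemma cut_promotions:
  assumes "As \<noteq> []" "closed_prfs vs As" "Bs \<noteq> []" "list_all2 (\<lambda>\<psi> B. \<psi> \<triangleright> map Bang As \<turnstile> B) \<psi>s Bs"
  shows "Cut 0 (tens_prf (map Prom vs))
      (tensL (map Bang As) ((ctr_block 0 As ^^ (length Bs - 1)) (tens_prf (map Prom \<psi>s))))
    \<approx> tens_prf (map (\<lambda>\<psi>. Prom (cuts 0 (map Prom vs) \<psi>)) \<psi>s) \<triangleright> [] \<turnstile> tens (map Bang Bs)"
proof -
  obtain \<psi> \<psi>s' B Bs' where eq: "\<psi>s = \<psi> # \<psi>s'" "Bs = B # Bs'"
    using assms by (cases \<psi>s; cases Bs) auto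
  obtain v vs' A As' where eq': "vs = v # vs'" "As = A # As'"
    using assms by (cases vs; cases As) auto
  let ?P = "map Prom vs" and ?T = "tens_prf (map Prom \<psi>s)"
  have P: "closed_prfs ?P (map Bang As)" by (rule closed_prfs_Prom[OF assms(2)])
  have len: "length \<psi>s' = length Bs'" using list_all2_lengthD[OF assms(4)] eq by simp
  have \<psi>s': "list_all2 (\<lambda>\<psi> B. \<psi> \<triangleright> map Bang As \<turnstile> B) (map Prom \<psi>s') (map Bang Bs')"
    and \<psi>: "Prom \<psi> \<triangleright> map Bang As \<turnstile> Bang B"
    using list_all2_Prom_proves[OF assms(4)] eq by simp_all
  have T: "?T \<triangleright> concat (replicate (Suc (length Bs')) (map Bang As)) \<turnstile> tens (map Bang Bs)"
    using tens_promotions_proves[OF assms(3,4)] eq by simp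
  have "Cut 0 (tens_prf ?P) (tensL (map Bang As) ((ctr_block 0 As ^^ length Bs') ?T))
      \<approx> cuts 0 ?P ((ctr_block 0 As ^^ length Bs') ?T) \<triangleright> [] \<turnstile> tens (map Bang Bs)"
    using cut_tensL_from[of "map Prom vs'" "map Bang As'" "Prom v" "Bang A" _ "[]"] P
      funpow_ctr_block_proves[OF T]
    unfolding tens_prf_def tensL_def by (simp add: eq')
  moreover note cuts_funpow_ctr_block[OF assms(2) T]
  moreover have "cuts 0 (concat (replicate (Suc (length Bs')) ?P)) ?T
      \<approx> foldl TensR (cuts 0 ?P (Prom \<psi>)) (map (cuts 0 ?P) (map Prom \<psi>s'))
      \<triangleright> [] \<turnstile> tens (map Bang Bs)"
    using cuts_foldl_tensR[OF \<psi>s' P P \<psi>] len unfolding eq tens_prf_def tens_def by simp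
  moreover have Prom: "cuts 0 ?P (Prom \<psi>) \<approx> Prom (cuts 0 ?P \<psi>) \<triangleright> [] \<turnstile> Bang B"
    if "\<psi> \<triangleright> map Bang As \<turnstile> B" for \<psi> B
    using cuts_Prom[OF assms(2), of \<psi> "[]" "[]"] that by simp
  have "foldl TensR (cuts 0 ?P (Prom \<psi>)) (map (\<lambda>\<psi>. cuts 0 ?P (Prom \<psi>)) \<psi>s')
      \<approx> foldl TensR (Prom (cuts 0 ?P \<psi>)) (map (\<lambda>\<psi>. Prom (cuts 0 ?P \<psi>)) \<psi>s')
      \<triangleright> [] \<turnstile> tens (map Bang Bs)"
    unfolding eq tens_def list.map list.sel
  proof (rule foldl_tensR_cong)
    show "list_all2 (\<lambda>\<psi> D. cuts 0 ?P (Prom \<psi>) \<approx> Prom (cuts 0 ?P \<psi>) \<triangleright> [] \<turnstile> D) \<psi>s' (map Bang Bs')"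
      using assms(4) unfolding eq list_all2_map2 by (auto elim!: list_all2_mono intro: Prom)
    show "cuts 0 ?P (Prom \<psi>) \<approx> Prom (cuts 0 ?P \<psi>) \<triangleright> [] \<turnstile> Bang B"
      using assms(4) unfolding eq by (auto intro: Prom)
  qed
  ultimately have "Cut 0 (tens_prf ?P) (tensL (map Bang As) ((ctr_block 0 As ^^ length Bs') ?T))
      \<approx> foldl TensR (Prom (cuts 0 ?P \<psi>)) (map (\<lambda>\<psi>. Prom (cuts 0 ?P \<psi>)) \<psi>s')
      \<triangleright> [] \<turnstile> tens (map Bang Bs)"
    unfolding map_map comp_def by (rule equiv_trans[OF equiv_trans[OF equiv_trans]])
  then show ?thesis by (simp add: eq tens_prf_def)
qed

section \<open>Functions on booleans\<close>

text \<open>This is the m-ary case distinction, nested to the right as in \<open>with_pow\<close>.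
  Both premises of \<open>WithR\<close> have the same context, so the branches share their
  hypotheses without contraction.\<close>

fun with_prf :: "nat \<Rightarrow> (nat \<Rightarrow> 'v derivation) \<Rightarrow> 'v derivation" where
  "with_prf (Suc 0) g = g 0"
| "with_prf (Suc (Suc m)) g = WithR (g 0) (with_prf (Suc m) (\<lambda>i. g (Suc i)))"

lemma with_prf_proves:
  assumes "\<And>i. g i \<triangleright> \<Gamma> \<turnstile> A" "m \<ge> 1"
  shows "with_prf m g \<triangleright> \<Gamma> \<turnstile> with_pow A m"
  using assms by (induction m g rule: with_prf.induct) (auto intro: proves.withR)

text \<open>An index beyond the range falls through to the last coordinate, since
  \<open>proj\<close> ignores its index at size 1; tables are therefore well typed whatever values
  their function takes.\<close>

lemma proj_proves:
  assumes "m \<ge> 1"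
  shows "proj A m i \<triangleright> [with_pow A m] \<turnstile> A"
  using assms
proof (induction A m i rule: proj.induct)
  case (2 A m)
  then show ?case
    using proves.lft[of "Ax A" "[]" "WithL1 A (with_pow A (Suc m))"] by (simp add: proves.ax)
next
  case (3 A m i)
  then show ?case using proves.lft[of _ "[]" "WithL2 A (with_pow A (Suc m))"] by simp
qed (auto intro: proves.ax)

lemma cut_with_prf_proj:
  assumes "\<And>i. g i \<triangleright> \<Gamma> \<turnstile> A" "v < m"
  shows "Cut 0 (with_prf m g) (proj A m v) \<approx> g v \<triangleright> \<Gamma> \<turnstile> A"
  using assms
proof (induction A m v arbitrary: g rule: proj.induct)
  case (1 A v)
  \<comment> \<open>At size 1 the bound forces \<open>v = 0\<close>, matching the only entry
    \<open>g 0\<close> of the tuple.\<close>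
  then show ?case by (simp add: cut_ax_right)
next
  case (2 A m)
  have "Cut 0 (with_prf (Suc (Suc m)) g) (proj A (Suc (Suc m)) 0) \<approx> Cut 0 (g 0) (Ax A) \<triangleright> \<Gamma> \<turnstile> A"
    using cut_with1[OF 2(1) with_prf_proves[OF 2(1)], of "Suc m" "Ax A" "[]" "[]"]
    by (simp add: proves.ax)
  from equiv_trans[OF this cut_ax_right[OF 2(1)]] show ?case .
next
  case (3 A m i)
  let ?W = "with_prf (Suc m) (\<lambda>i. g (Suc i))"
  have "Cut 0 (with_prf (Suc (Suc m)) g) (proj A (Suc (Suc m)) (Suc i))
      \<approx> Cut 0 ?W (proj A (Suc m) i) \<triangleright> \<Gamma> \<turnstile> A"
    using cut_with2[OF 3(2) with_prf_proves[OF 3(2)], of "Suc m" "proj A (Suc m) i" "[]" "[]"]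
      proj_proves[of "Suc m" A i] by simp
  moreover have "Cut 0 ?W (proj A (Suc m) i) \<approx> g (Suc i) \<triangleright> \<Gamma> \<turnstile> A"
    using 3(1)[of "\<lambda>i. g (Suc i)"] 3(2,3) by simp
  ultimately show ?case by (rule equiv_trans)
qed auto

section \<open>Decision tables for functions of booleans\<close>

lemma boolean_prf_proves: "m \<ge> 1 \<Longrightarrow> boolean_prf A m v \<triangleright> [] \<turnstile> boolean A m"
  unfolding boolean_prf_def boolean_def by (rule proves.lolR) (rule proj_proves)

lemma closed_prfs_booleans:
  "length vs = length ms \<Longrightarrow> \<forall>m\<in>set ms. m \<ge> 1 \<Longrightarrow>
    closed_prfs (map2 (boolean_prf A) ms vs) (map (boolean A) ms)"
  by (auto simp: list_all2_conv_all_nth intro: boolean_prf_proves)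

text \<open>The head of the list of sizes belongs to the last boolean hypothesis: it is the one whose cut
  is principal for \<open>LolL\<close> without commuting past the others.\<close>

fun table :: "'v fm \<Rightarrow> nat \<Rightarrow> nat list \<Rightarrow> (nat list \<Rightarrow> nat) \<Rightarrow> 'v derivation" where
  "table A k [] f = proj A k (f [])"
| "table A k (m # ms) f = LolL 0 (with_prf m (\<lambda>v. table A k ms (\<lambda>vs. f (v # vs)))) (Ax A)"

lemma table_proves:
  assumes "k \<ge> 1" "\<forall>m\<in>set ms. m \<ge> 1"
  shows "table A k ms f \<triangleright> with_pow A k # map (boolean A) (rev ms) \<turnstile> A"
  using assms(2)
proof (induction ms arbitrary: f)
  case Nil
  then show ?case using assms(1) by (simp add: proj_proves)
next
  case (Cons m ms)
  then have "with_prf m (\<lambda>v. table A k ms (\<lambda>vs. f (v # vs)))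
      \<triangleright> with_pow A k # map (boolean A) (rev ms) \<turnstile> with_pow A m"
    by (intro with_prf_proves) auto
  from proves.lolL[OF this, of "Ax A" "[]" A "[]" A]
  show ?case by (simp add: proves.ax boolean_def[of A m])
qed

text \<open>Each argument costs one principal cut for -o followed by a projection, which selects the
  branch \<open>?t v\<close>; the other arguments are then cut into that branch alone, where
  \<open>f\<close> has been specialised to \<open>v\<close>. Cutting starts at position 1 because
  position 0 holds the output tuple, and the proofs are reversed because \<open>table\<close> lists
  the last hypothesis at the head.\<close>

lemma cuts_table:
  assumes "k \<ge> 1" "\<forall>m\<in>set ms. m \<ge> 1" "list_all2 (<) vs ms"
  shows "cuts 1 (rev (map2 (boolean_prf A) ms vs)) (table A k ms f) \<approx> proj A k (f vs)
    \<triangleright> [with_pow A k] \<turnstile> A"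
  using assms(3,2)
proof (induction arbitrary: f rule: list_all2_induct)
  case Nil
  then show ?case using assms(1) by (simp add: proj_proves equiv_refl)
next
  case (Cons v vs m ms)
  let ?t = "\<lambda>v. table A k ms (\<lambda>vs. f (v # vs))"
  let ?\<Theta> = "with_pow A k # map (boolean A) (rev ms)"
  let ?bs = "rev (map2 (boolean_prf A) ms vs)"
  have len: "length vs = length ms" using Cons.hyps(2) by (rule list_all2_lengthD)
  have t: "?t v \<triangleright> ?\<Theta> \<turnstile> A" for v using Cons.prems assms(1) by (intro table_proves) auto
  have m: "m \<ge> 1" using Cons.prems by simp
  have W: "with_prf m ?t \<triangleright> ?\<Theta> \<turnstile> with_pow A m" using t m by (rule with_prf_proves)
  have "Cut (length ?\<Theta>) (boolean_prf A m v) (table A k (m # ms) f)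
      \<approx> Cut 0 (Cut 0 (with_prf m ?t) (proj A m v)) (Ax A) \<triangleright> ?\<Theta> \<turnstile> A"
    using cut_lol[OF proj_proves[OF m] W, of "Ax A" "[]" "[]" A v]
    by (simp add: proves.ax boolean_prf_def)
  moreover have "Cut 0 (Cut 0 (with_prf m ?t) (proj A m v)) (Ax A)
      \<approx> Cut 0 (with_prf m ?t) (proj A m v) \<triangleright> ?\<Theta> \<turnstile> A"
    using proves.cut[OF W, of "proj A m v" "[]" "[]" A] proj_proves[OF m, of A v]
    by (intro cut_ax_right) simp
  moreover have "Cut 0 (with_prf m ?t) (proj A m v) \<approx> ?t v \<triangleright> ?\<Theta> \<turnstile> A"
    using t Cons.hyps(1) by (rule cut_with_prf_proj)
  ultimately have "Cut (length ?\<Theta>) (boolean_prf A m v) (table A k (m # ms) f) \<approx> ?t v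
      \<triangleright> ?\<Theta> \<turnstile> A"
    by (rule equiv_trans[OF equiv_trans])
  moreover have "closed_prfs ?bs (map (boolean A) (rev ms))"
    using closed_prfs_booleans[OF len, of A] Cons.prems by (simp add: rev_map[symmetric])
  ultimately have "cuts 1 ?bs (Cut (length ?\<Theta>) (boolean_prf A m v) (table A k (m # ms) f))
      \<approx> cuts 1 ?bs (?t v) \<triangleright> [with_pow A k] \<turnstile> A"
    using cuts_cong[of ?bs _ _ _ "[with_pow A k]" "[]"] by simp
  moreover have "cuts 1 ?bs (?t v) \<approx> proj A k (f (v # vs)) \<triangleright> [with_pow A k] \<turnstile> A"
    using Cons.IH Cons.prems by simp
  ultimately have "cuts 1 ?bs (Cut (length ?\<Theta>) (boolean_prf A m v) (table A k (m # ms) f))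
      \<approx> proj A k (f (v # vs)) \<triangleright> [with_pow A k] \<turnstile> A"
    by (rule equiv_trans)
  \<comment> \<open>In the reversed list the proof for \<open>m\<close> comes last, at position 1 +
    \<open>length ?bs\<close>, which is \<open>length ?\<Theta>\<close>.\<close>
  then show ?case using len by (simp add: cuts_append)
qed

text \<open>\<open>LolR\<close> discharges the output tuple, which \<open>table\<close> keeps as its
  foremost hypothesis for this purpose. The two reversals compensate for \<open>table\<close>
  consuming its arguments from the last to the first.\<close>

definition fun_prf :: "'v fm \<Rightarrow> nat list \<Rightarrow> nat \<Rightarrow> (nat list \<Rightarrow> nat) \<Rightarrow> 'v derivation" where
  "fun_prf A ms k f = LolR (table A k (rev ms) (\<lambda>vs. f (rev vs)))"

lemma fun_prf_proves:
  assumes "k \<ge> 1" "\<forall>m\<in>set ms. m \<ge> 1"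
  shows "fun_prf A ms k f \<triangleright> map (boolean A) ms \<turnstile> boolean A k"
  using table_proves[of k "rev ms"] assms unfolding fun_prf_def boolean_def[of A k]
  by (auto intro: proves.lolR)

lemma cuts_fun_prf:
  assumes "k \<ge> 1" "\<forall>m\<in>set ms. m \<ge> 1" "list_all2 (<) vs ms"
  shows "cuts 0 (map2 (boolean_prf A) ms vs) (fun_prf A ms k f) \<approx> boolean_prf A k (f vs)
    \<triangleright> [] \<turnstile> boolean A k"
proof -
  let ?bs = "map2 (boolean_prf A) ms vs"
  let ?t = "table A k (rev ms) (\<lambda>vs. f (rev vs))"
  have len: "length vs = length ms" using assms(3) by (rule list_all2_lengthD)
  have "cuts 0 ?bs (LolR ?t) \<approx> LolR (cuts 1 ?bs ?t) \<triangleright> [] \<turnstile> boolean A k"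
    using cuts_lolR[OF closed_prfs_booleans[OF len assms(2), of A], of ?t "with_pow A k" "[]" "[]" A]
      table_proves[of k "rev ms" A "\<lambda>vs. f (rev vs)"] assms by (simp add: boolean_def[of A k])
  moreover have "?bs = rev (map2 (boolean_prf A) (rev ms) (rev vs))"
    using len by (simp add: rev_map zip_rev)
  then have "cuts 1 ?bs ?t \<approx> proj A k (f vs) \<triangleright> [with_pow A k] \<turnstile> A"
    using cuts_table[of k "rev ms" "rev vs" A "\<lambda>vs. f (rev vs)"] assms by simp
  then have "LolR (cuts 1 ?bs ?t) \<approx> boolean_prf A k (f vs) \<triangleright> [] \<turnstile> boolean A k"
    unfolding boolean_prf_def boolean_def by (rule cong_lolR)
  ultimately show ?thesis unfolding fun_prf_def by (rule equiv_trans)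
qed

text \<open>\<open>outs\<close> lists, for each component of the result, its number of values and the function
  computing it.\<close>

lemma boolean_functions_cw_plain:
  fixes A :: "'v fm" and outs :: "(nat \<times> (nat list \<Rightarrow> nat)) list"
  assumes "ms \<noteq> []" "\<forall>m\<in>set ms. m \<ge> 1" "outs \<noteq> []" "\<forall>(k, f)\<in>set outs. k \<ge> 1"
  defines "As \<equiv> map (boolean A) ms" and "Bs \<equiv> map (\<lambda>(k, f). boolean A k) outs"
  shows "\<exists>\<phi>. \<phi> \<triangleright> [tens (map Bang As)] \<turnstile> tens (map Bang Bs) \<and> cw_plain_tens As Bs \<phi> \<and>
    (\<forall>vs. list_all2 (<) vs ms \<longrightarrow>
      Cut 0 (tens_prf (map Prom (map2 (boolean_prf A) ms vs))) \<phi>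
        \<approx> tens_prf (map (\<lambda>(k, f). Prom (boolean_prf A k (f vs))) outs) \<triangleright> [] \<turnstile> tens (map Bang Bs))"
proof (intro exI conjI allI impI)
  \<comment> \<open>Every component derelicts all arguments for itself; the copies needed are merged
    by the block contractions in \<open>\<psi>\<close>.\<close>
  define \<psi>s where "\<psi>s = map (\<lambda>(k, f). der_from 0 As (fun_prf A ms k f)) outs"
  define \<psi> where "\<psi> = (ctr_block 0 As ^^ (length Bs - 1)) (tens_prf (map Prom \<psi>s))"
  have plain: "list_all2 (plain As) Bs \<psi>s"
    unfolding \<psi>s_def Bs_def list_all2_map1 list_all2_map2
  proof (rule list.rel_refl_strong)
    fix x assume "x \<in> set outs"
    then obtain k f where kf: "x = (k, f)" "k \<ge> 1" using assms(4) by auto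
    show "plain As (case x of (k, f) \<Rightarrow> boolean A k)
        (case x of (k, f) \<Rightarrow> der_from 0 As (fun_prf A ms k f))"
      using plain_der_from[OF fun_prf_proves[OF kf(2) assms(2)]] by (simp add: kf(1) As_def)
  qed
  have cw: "cw_plain As Bs \<psi>"
    unfolding \<psi>_def using assms(3) plain by (intro cw_plain_promotions) (auto simp: Bs_def)
  then have "\<psi> \<triangleright> map Bang As \<turnstile> tens (map Bang Bs)" by (simp add: cw_plain_def)
  then show typing: "tensL (map Bang As) \<psi> \<triangleright> [tens (map Bang As)] \<turnstile> tens (map Bang Bs)"
    using tensL_from_proves[of \<psi> _ _ "[]"] assms(1) unfolding tensL_def tens_def As_def
    by (cases ms) auto
  show "cw_plain_tens As Bs (tensL (map Bang As) \<psi>)"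
    unfolding cw_plain_tens_def using cw assms(1) equiv_refl[OF typing] by (auto simp: As_def)
  fix vs assume vs: "list_all2 (<) vs ms"
  let ?vs = "map2 (boolean_prf A) ms vs"
  have cl: "closed_prfs ?vs As"
    unfolding As_def using vs assms(2) by (intro closed_prfs_booleans) (auto dest: list_all2_lengthD)
  have "list_all2 (\<lambda>\<psi> B. \<psi> \<triangleright> map Bang As \<turnstile> B) \<psi>s Bs"
    using plain by (auto simp: list_all2_conv_all_nth plain_def)
  then have "Cut 0 (tens_prf (map Prom ?vs)) (tensL (map Bang As) \<psi>)
      \<approx> tens_prf (map (\<lambda>\<psi>. Prom (cuts 0 (map Prom ?vs) \<psi>)) \<psi>s) \<triangleright> [] \<turnstile> tens (map Bang Bs)"
    unfolding \<psi>_def using assms(1,3) cl by (intro cut_promotions) (auto simp: As_def Bs_def)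
  moreover
  let ?p = "\<lambda>(k, f). Prom (cuts 0 (map Prom ?vs) (der_from 0 As (fun_prf A ms k f)))"
  let ?q = "\<lambda>(k, f). Prom (boolean_prf A k (f vs))"
  have comp: "?p x \<approx> ?q x \<triangleright> [] \<turnstile> Bang (case x of (k, f) \<Rightarrow> boolean A k)"
    if x: "x \<in> set outs" for x
  proof -
    obtain k f where kf: "x = (k, f)" "k \<ge> 1" using x assms(4) by auto
    \<comment> \<open>Inside its promotion a component is evaluated on bare booleans: promotions
      cancel derelictions, and the table looks up the value.\<close>
    have "cuts 0 (map Prom ?vs) (der_from 0 As (fun_prf A ms k f))
        \<approx> cuts 0 ?vs (fun_prf A ms k f) \<triangleright> [] \<turnstile> boolean A k"
      using cuts_der_from[OF cl, of "fun_prf A ms k f" "[]" "[]" "boolean A k"]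
        fun_prf_proves[OF kf(2) assms(2), of A f]
      by (simp add: As_def)
    from equiv_trans[OF this cuts_fun_prf[OF kf(2) assms(2) vs]]
    show ?thesis using cong_prom[of _ _ "[]"] by (simp add: kf(1))
  qed
  obtain x xs where eq: "outs = x # xs" using assms(3) by (cases outs) auto
  have "foldl TensR (?p x) (map ?p xs) \<approx> foldl TensR (?q x) (map ?q xs)
      \<triangleright> [] \<turnstile> foldl Tens (Bang (case x of (k, f) \<Rightarrow> boolean A k))
        (map (\<lambda>x. Bang (case x of (k, f) \<Rightarrow> boolean A k)) xs)"
  proof (rule foldl_tensR_cong)
    show "list_all2 (\<lambda>x D. ?p x \<approx> ?q x \<triangleright> [] \<turnstile> D) xs
        (map (\<lambda>x. Bang (case x of (k, f) \<Rightarrow> boolean A k)) xs)"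
      unfolding list_all2_map2 by (rule list.rel_refl_strong) (rule comp, simp add: eq)
  qed (rule comp, simp add: eq)
  then have "tens_prf (map (\<lambda>\<psi>. Prom (cuts 0 (map Prom ?vs) \<psi>)) \<psi>s) \<approx> tens_prf (map ?q outs)
      \<triangleright> [] \<turnstile> tens (map Bang Bs)"
    unfolding tens_prf_def tens_def \<psi>s_def Bs_def eq
    by (simp add: comp_def case_prod_unfold)
  ultimately show "Cut 0 (tens_prf (map Prom ?vs)) (tensL (map Bang As) \<psi>)
      \<approx> tens_prf (map ?q outs) \<triangleright> [] \<turnstile> tens (map Bang Bs)"
    by (rule equiv_trans)
qed

section \<open>One machine step as a tuple of functions of booleans\<close>

lemma length_step_tape: "length (step_tape h \<sigma> c d) = 2 * h + 3"
  by (cases d) simp_all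

text \<open>Used to replace a tape decoded from an argument list by \<open>\<sigma>\<close>, with
  which it is only known to agree on the window.\<close>

lemma step_tape_cong:
  "(\<And>j. j \<in> {- int h..int h} \<Longrightarrow> \<sigma> j = \<tau> j) \<Longrightarrow> step_tape h \<sigma> c d = step_tape h \<tau> c d"
  by (cases d) auto

theorem proposition5p5:
  fixes n s h :: nat and A :: "'v fm"
    and \<delta> :: "nat \<times> nat \<Rightarrow> nat \<times> nat \<times> dir"
  assumes "n \<ge> 1" and "s \<ge> 1"
    and "\<delta> \<in> {..<s} \<times> {..<n} \<rightarrow> {..<s} \<times> {..<n} \<times> UNIV"
  shows "\<exists>relstep :: 'v derivation.
    relstep \<triangleright> [tens (replicate (2 * h + 1) (Bang (boolean A s)) @ [Bang (boolean A n)])]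
      \<turnstile> tens (replicate (2 * h + 3) (Bang (boolean A s)) @ [Bang (boolean A n)]) \<and>
    cw_plain_tens (replicate (2 * h + 1) (boolean A s) @ [boolean A n])
      (replicate (2 * h + 3) (boolean A s) @ [boolean A n]) relstep \<and>
    (\<forall>(\<sigma> :: int \<Rightarrow> nat) q \<sigma>0' q' d.
       (\<forall>j \<in> {- int h..int h}. \<sigma> j < s) \<longrightarrow> q < n \<longrightarrow> \<delta> (\<sigma> 0, q) = (\<sigma>0', q', d) \<longrightarrow>
       Cut 0 (config_prf A s n (map \<sigma> [- int h..int h]) q) relstep
         \<approx> config_prf A s n (step_tape h \<sigma> \<sigma>0' d) q'
         \<triangleright> [] \<turnstile> tens (replicate (2 * h + 3) (Bang (boolean A s)) @ [Bang (boolean A n)]))"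
proof -
  define ms where "ms = replicate (2 * h + 1) s @ [n]"
  \<comment> \<open>Arguments are listed by relative coordinate from -h upwards, so coordinate
    \<open>j\<close> has index \<open>j + h\<close>; the state follows at index
    \<open>2 * h + 1\<close>.\<close>
  define tape where "tape vs = (\<lambda>j. vs ! nat (j + int h))" for vs :: "nat list"
  \<comment> \<open>The whole new configuration as one list: \<open>2 * h + 3\<close> symbols, then
    the new state at index \<open>2 * h + 3\<close>.\<close>
  define out where "out vs = (case \<delta> (tape vs 0, vs ! (2 * h + 1)) of
    (c, q', d) \<Rightarrow> step_tape h (tape vs) c d @ [q'])" for vs
  \<comment> \<open>Each component reads one entry of \<open>out\<close>. Even a copied or blank
    symbol depends on the direction, hence on the scanned symbol and the state, so all components
    are given the full configuration.\<close>
  define outs where "outs = map (\<lambda>j. (s, \<lambda>vs. out vs ! j)) [0..<2 * h + 3]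
    @ [(n, \<lambda>vs. out vs ! (2 * h + 3))]"
  have As: "map (boolean A) ms = replicate (2 * h + 1) (boolean A s) @ [boolean A n]"
    unfolding ms_def by simp
  have Bs: "map (\<lambda>(k, f). boolean A k) outs = replicate (2 * h + 3) (boolean A s) @ [boolean A n]"
    unfolding outs_def by (simp add: comp_def map_replicate_const)
  have "\<forall>m\<in>set ms. m \<ge> 1" "\<forall>(k, f)\<in>set outs. k \<ge> 1" "ms \<noteq> []" "outs \<noteq> []"
    using assms by (auto simp: ms_def outs_def)
  then obtain \<phi> where \<phi>: "\<phi> \<triangleright> [tens (map Bang (map (boolean A) ms))]
      \<turnstile> tens (map Bang (map (\<lambda>(k, f). boolean A k) outs))"
    "cw_plain_tens (map (boolean A) ms) (map (\<lambda>(k, f). boolean A k) outs) \<phi>"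
    "\<And>vs. list_all2 (<) vs ms \<Longrightarrow> Cut 0 (tens_prf (map Prom (map2 (boolean_prf A) ms vs))) \<phi>
        \<approx> tens_prf (map (\<lambda>(k, f). Prom (boolean_prf A k (f vs))) outs)
        \<triangleright> [] \<turnstile> tens (map Bang (map (\<lambda>(k, f). boolean A k) outs))"
    using boolean_functions_cw_plain by metis
  show ?thesis
  proof (intro exI[of _ \<phi>] conjI allI impI)
    show "\<phi> \<triangleright> [tens (replicate (2 * h + 1) (Bang (boolean A s)) @ [Bang (boolean A n)])]
      \<turnstile> tens (replicate (2 * h + 3) (Bang (boolean A s)) @ [Bang (boolean A n)])"
      using \<phi>(1) unfolding As Bs by simp
    show "cw_plain_tens (replicate (2 * h + 1) (boolean A s) @ [boolean A n])
      (replicate (2 * h + 3) (boolean A s) @ [boolean A n]) \<phi>"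
      using \<phi>(2) unfolding As Bs .
    fix \<sigma> :: "int \<Rightarrow> nat" and q \<sigma>0' q' d
    assume \<sigma>: "\<forall>j \<in> {- int h..int h}. \<sigma> j < s" and q: "q < n"
      and \<delta>: "\<delta> (\<sigma> 0, q) = (\<sigma>0', q', d)"
    define ws where "ws = map \<sigma> [- int h..int h]"
    define vs where "vs = ws @ [q]"
    have ws: "length ws = 2 * h + 1" unfolding ws_def by simp
    have "list_all2 (<) ws (replicate (2 * h + 1) s)"
      using \<sigma> ws unfolding list_all2_conv_all_nth by (simp add: ws_def del: replicate_Suc)
    then have vs: "list_all2 (<) vs ms"
      using q unfolding vs_def ms_def by (intro list_all2_appendI) auto
    \<comment> \<open>Within the window the index stays below \<open>length ws\<close>, so the
      lookup cannot reach the state appended at the end.\<close>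
    have tape: "tape vs j = \<sigma> j" if "j \<in> {- int h..int h}" for j
    proof -
      have "nat (j + int h) < length ws" using that ws by auto
      then show ?thesis
        using that by (simp add: tape_def vs_def nth_append ws_def)
    qed
    have out: "out vs = step_tape h \<sigma> \<sigma>0' d @ [q']"
      using \<delta> tape[of 0] step_tape_cong[of h "tape vs" \<sigma>, OF tape] ws
      by (simp add: out_def vs_def nth_append)
    have args: "map Prom (map2 (boolean_prf A) ms vs)
        = map (\<lambda>i. Prom (boolean_prf A s i)) ws @ [Prom (boolean_prf A n q)]"
      using ws unfolding ms_def vs_def by (simp add: zip_replicate1 comp_def del: replicate_Suc)
    have "map (\<lambda>j. Prom (boolean_prf A s (out vs ! j))) [0..<2 * h + 3]
        = map (\<lambda>i. Prom (boolean_prf A s i)) (step_tape h \<sigma> \<sigma>0' d)"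
      using length_step_tape[of h \<sigma> \<sigma>0' d]
      by (intro nth_equalityI) (simp_all add: out nth_append del: upt_Suc)
    then have result: "map (\<lambda>(k, f). Prom (boolean_prf A k (f vs))) outs
        = map (\<lambda>i. Prom (boolean_prf A s i)) (step_tape h \<sigma> \<sigma>0' d) @ [Prom (boolean_prf A n q')]"
      using length_step_tape[of h \<sigma> \<sigma>0' d]
      by (simp add: outs_def comp_def out nth_append del: upt_Suc)
    from \<phi>(3)[OF vs]
    show "Cut 0 (config_prf A s n (map \<sigma> [- int h..int h]) q) \<phi>
        \<approx> config_prf A s n (step_tape h \<sigma> \<sigma>0' d) q'
        \<triangleright> [] \<turnstile> tens (replicate (2 * h + 3) (Bang (boolean A s)) @ [Bang (boolean A n)])"
      unfolding args result Bs config_prf_def ws_def by simp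
  qed
qed

end
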